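(* Let $\Omega\cong R_1\times\cdots\times R_k$ be a finite commutative ring, where each $R_i$ is a finite local ring, and let $u_i=|U(R_i)|$. If every $R_i$ is a field, then $b_{k-1}(u_1,\ldots,u_k)=\sigma_k(u_1,\ldots,u_k)$ and $$b_{k-j}(u_1,\ldots,u_k)=A_{j-1,1}\,\sigma_{k-j}(u_1,\ldots,u_k)+\cdots+A_{j-1,j-1}\,\sigma_{k-2j+2}(u_1,\ldots,u_k)$$ for any $j\ge 2$. The numbers $A_{i,j}$ satisfy the recurrence relation $$A_{j-1,t}=A_{j-2,t-1}\binom{j+t-2}{1}+A_{j-3,t-1}\binom{j+t-2}{2}+\cdots+A_{t-1,t-1}\binom{j+t-2}{j-t}$$ and $A_{j,1}=1$.
   Context: All rings are commutative with identity. $U(R)$ is the set of units of $R$. For a ring $R$, $K(R)$ is the clique complex of the zero-divisor graph $\Gamma(R)$, whose vertices are the nonzero zero-divisors of $R$ and in which distinct $a,b$ are adjacent iff $ab=0$. $\tilde H_n$ is reduced simplicial homology with integer coefficients. For $\Omega\cong R_1\times\cdots\times R_k$ with $u_i=|U(R_i)|$, $b_n(u_1,\ldots,u_k)$ denotes the Betti number $\operatorname{rank}\tilde H_n(K(\Omega))$. The case of interest is $n\le k-1$, since $\tilde H_n(K(\Omega))=0$ for $n\ge k$. Further, $$\sigma_j(u_1,\ldots,u_k)=\sum_{1\le i_1<\cdots<i_j\le k}(u_{i_1}-1)\cdots(u_{i_j}-1)\,u_{n_1}\cdots u_{n_{k-j}},$$ where $\{n_1,\ldots,n_{k-j}\}=\{1,2,\ldots,k\}\setminus\{i_1,\ldots,i_j\}$;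 if $j>k$ or $j<0$, then $\sigma_j(u_1,\ldots,u_k)=0$.
   Formalization: The formulas are proved for k ≥ 2 and, in the second, j ≠ k: for j = k ≥ 2 the complex is connected, so b_0 = 0 while the formula gives u_1⋯u_k > 0 (e.g. F_2×F_2), and for k = 1 the complex is empty, so b_0 = 0 ≠ u_1−1 (e.g. F_3). *)

theory Defs
  imports "HOL-Algebra.Algebra"
begin

section \<open>The zero-divisor graph and its clique complex\<close>

definition nonzero_zero_divisors :: "('a, 'm) ring_scheme \<Rightarrow> 'a set" where
  "nonzero_zero_divisors R =
     {a \<in> carrier R. a \<noteq> \<zero>\<^bsub>R\<^esub> \<and> (\<exists>b\<in>carrier R. b \<noteq> \<zero>\<^bsub>R\<^esub> \<and> a \<otimes>\<^bsub>R\<^esub> b = \<zero>\<^bsub>R\<^esub>)}"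

definition zero_divisor_adj :: "('a, 'm) ring_scheme \<Rightarrow> 'a \<Rightarrow> 'a \<Rightarrow> bool" where
  "zero_divisor_adj R a b \<longleftrightarrow>
     a \<in> nonzero_zero_divisors R \<and> b \<in> nonzero_zero_divisors R \<and> a \<noteq> b \<and> a \<otimes>\<^bsub>R\<^esub> b = \<zero>\<^bsub>R\<^esub>"

text \<open>Abstract simplicial complexes are represented by their set of simplices, the empty simplex
  included; this makes the chain complex below the augmented one.\<close>

definition clique_complex :: "'v set \<Rightarrow> ('v \<Rightarrow> 'v \<Rightarrow> bool) \<Rightarrow> 'v set set" where
  "clique_complex V adj = {S. finite S \<and> S \<subseteq> V \<and> (\<forall>a\<in>S. \<forall>b\<in>S. a \<noteq> b \<longrightarrow> adj a b)}"

definition zero_divisor_complex :: "('a, 'm) ring_scheme \<Rightarrow> 'a set set" where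
  "zero_divisor_complex R = clique_complex (nonzero_zero_divisors R) (zero_divisor_adj R)"

section \<open>Reduced simplicial homology\<close>

definition ordered_simplices :: "'v set set \<Rightarrow> int \<Rightarrow> 'v list set" where
  "ordered_simplices K n = {xs. distinct xs \<and> set xs \<in> K \<and> int (length xs) = n + 1}"

text \<open>Oriented simplicial chains with integer coefficients: finitely supported functions on the
  ordered \<open>n\<close>-simplices that change sign under every transposition of the vertices. The
  oriented simplex \<open>[v\<^sub>0, \<dots>, v\<^sub>n]\<close> is the function with value \<open>\<plusminus>1\<close> on the
  even, respectively odd, reorderings of \<open>v\<^sub>0, \<dots>, v\<^sub>n\<close> and value \<open>0\<close> elsewhere. In degree
  \<open>-1\<close> the only ordered simplex is the empty list, which gives the group of integers.\<close>

definition oriented_chains :: "'v set set \<Rightarrow> int \<Rightarrow> ('v list \<Rightarrow> int) set" where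
  "oriented_chains K n =
     {c. finite {xs. c xs \<noteq> 0} \<and> {xs. c xs \<noteq> 0} \<subseteq> ordered_simplices K n \<and>
         (\<forall>xs i j. i < j \<and> j < length xs \<longrightarrow> c (xs[i := xs ! j, j := xs ! i]) = - c xs)}"

definition chain_group :: "'v set set \<Rightarrow> int \<Rightarrow> ('v list \<Rightarrow> int) monoid" where
  "chain_group K n =
     \<lparr>carrier = oriented_chains K n, monoid.mult = (\<lambda>c d xs. c xs + d xs), one = (\<lambda>_. 0)\<rparr>"

text \<open>The usual boundary, the alternating sum of the faces \<open>[v\<^sub>0, \<dots>, v\<^sub>n]\<close> with \<open>v\<^sub>i\<close> omitted:
  the coefficient of \<open>[v\<^sub>0, \<dots>, v\<^sub>n]\<close> equals \<open>(-1)\<close> to the power \<open>i\<close> times that of the ordering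
  with \<open>v\<^sub>i\<close> moved to the front, so the coefficient of a face \<open>xs\<close> in the boundary is the sum of
  the coefficients of all \<open>v # xs\<close>. In degree \<open>0\<close> this is the augmentation.\<close>

definition boundary :: "('v list \<Rightarrow> int) \<Rightarrow> 'v list \<Rightarrow> int" where
  "boundary c = (\<lambda>xs. \<Sum>v | c (v # xs) \<noteq> 0. c (v # xs))"

definition cycles :: "'v set set \<Rightarrow> int \<Rightarrow> ('v list \<Rightarrow> int) set" where
  "cycles K n = kernel (chain_group K n) (chain_group K (n - 1)) boundary"

definition boundaries :: "'v set set \<Rightarrow> int \<Rightarrow> ('v list \<Rightarrow> int) set" where
  "boundaries K n = boundary ` carrier (chain_group K (n + 1))"

definition reduced_homology :: "'v set set \<Rightarrow> int \<Rightarrow> ('v list \<Rightarrow> int) set monoid" where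
  "reduced_homology K n = (chain_group K n)\<lparr>carrier := cycles K n\<rparr> Mod boundaries K n"

section \<open>Rank of an abelian group and Betti numbers\<close>

definition int_independent :: "('a, 'm) monoid_scheme \<Rightarrow> 'a set \<Rightarrow> bool" where
  "int_independent G S \<longleftrightarrow> S \<subseteq> carrier G \<and>
     (\<forall>T m. finite T \<and> T \<subseteq> S \<and> (\<Otimes>\<^bsub>G\<^esub>x\<in>T. x [^]\<^bsub>G\<^esub> (m x :: int)) = \<one>\<^bsub>G\<^esub>
        \<longrightarrow> (\<forall>x\<in>T. m x = 0))"

text \<open>Only meaningful for abelian groups of finite rank, in particular finitely generated ones.\<close>

definition abelian_rank :: "('a, 'm) monoid_scheme \<Rightarrow> nat" where
  "abelian_rank G = Sup {card S |S. finite S \<and> int_independent G S}"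

definition betti :: "'v set set \<Rightarrow> int \<Rightarrow> nat" where
  "betti K n = abelian_rank (reduced_homology K n)"

section \<open>The numbers in the formula\<close>

text \<open>\<open>I\<close> is the set of indices contributing a factor \<open>u\<^sub>i - 1\<close>; for \<open>j < 0\<close> or \<open>j > length us\<close>
  the sum is empty.\<close>

definition sigma :: "int \<Rightarrow> nat list \<Rightarrow> int" where
  "sigma j us = (\<Sum>I | I \<subseteq> {..<length us} \<and> int (card I) = j.
     (\<Prod>i\<in>I. int (us ! i) - 1) * (\<Prod>i\<in>{..<length us} - I. int (us ! i)))"

text \<open>Only the values for \<open>1 \<le> t \<le> i\<close> are relevant. The second clause is the recurrence
  \<open>A\<^sub>i\<^sub>,\<^sub>t = (\<Sum>s. A\<^sub>i\<^sub>-\<^sub>s\<^sub>,\<^sub>t\<^sub>-\<^sub>1 (i + t - 1 choose s))\<close>, with \<open>t = Suc (Suc r)\<close>.\<close>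

fun coeffA :: "nat \<Rightarrow> nat \<Rightarrow> nat" where
  "coeffA i 0 = 0"
| "coeffA i (Suc 0) = 1"
| "coeffA i (Suc (Suc r)) =
     (\<Sum>s = 1..i - Suc r. coeffA (i - s) (Suc r) * ((i + Suc r) choose s))"

end

theory Submission
  imports Defs
begin

text \<open>The ring is a product of \<open>k\<close> finite fields, so its elements are vectors with supports in
  \<open>{..<k}\<close>. Two vectors multiply to zero iff their supports are disjoint, and the nonzero
  zero-divisors are the vectors whose support is nonempty and proper. The clique complex therefore has
  as simplices the sets of such vectors with pairwise disjoint supports.

  The topology rests on one principle. If a vertex \<open>v\<close> is dominated by another vertex \<open>w\<close>, that is,
  all neighbours of \<open>v\<close> are neighbours of \<open>w\<close>, then the link of \<open>v\<close> is contractible in the rest of the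
  complex, and the complex has the homology of the wedge of the deletion of \<open>v\<close> and the suspension
  of its link (\<open>dominated_vertex.free_homology_add\<close>). Fix a coordinate \<open>x\<close> and a vector \<open>e\<close> with support \<open>{x}\<close>.
  The vectors not joined to \<open>e\<close> are the other vectors with \<open>x\<close> in their support. They are pairwise not
  joined and dominated by \<open>e\<close>; once all of them are removed, a cone with apex \<open>e\<close> remains
  (\<open>free_homology_star\<close>). So the homology in degree \<open>n\<close> is free, and its rank is the sum over these
  vectors \<open>v\<close> of the rank in degree \<open>n - 1\<close> of the link of \<open>v\<close>, which is the complex of the same kind on
  the coordinates outside the support of \<open>v\<close>.

  Unwinding the recursion, the rank in degree \<open>m - 1\<close> counts the partitions of the coordinates into \<open>m\<close>
  blocks together with a vector supported on each block, other than one chosen vector on each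
  singleton block (\<open>free_homology_disjoint_supports\<close>). A block \<open>B\<close> with at least two points contributes the
  product of the \<open>u i\<close> over \<open>B\<close>, a singleton \<open>{i}\<close> contributes \<open>u i - 1\<close>. The partitions with a prescribed set
  of singletons have equal weights and are counted by associated Stirling numbers, so summation over
  the sets of singletons yields the expressions \<open>sigma\<close>. The recurrence for the numbers \<open>coeffA\<close> is the
  recurrence of the associated Stirling numbers, which splits partitions by the block of a fixed
  point (\<open>coeffA_eq_assoc_stirling\<close>, \<open>weighted_partitions_coeffA\<close>). The case \<open>j = k\<close>, degree \<open>0\<close>, is
  exceptional because it would count the partition into a single block, and the vectors of full
  support are units.\<close>

section \<open>Alternating chains and cones\<close>

text \<open>Only adjacent transpositions are mentioned, which is what a recursion along the list can
  verify; they generate all the others.\<close>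
definition alternating :: "('v list \<Rightarrow> int) \<Rightarrow> bool" where
  "alternating c \<longleftrightarrow> (\<forall>xs x y ys. c (xs @ x # y # ys) = - c (xs @ y # x # ys))"

lemma alternatingD: "alternating c \<Longrightarrow> c (xs @ x # y # ys) = - c (xs @ y # x # ys)"
  unfolding alternating_def by blast

lemma alternating_swap:
  assumes "alternating c"
  shows "c (xs @ x # bs @ y # cs) = - c (xs @ y # bs @ x # cs)"
proof (induction bs arbitrary: xs)
  case Nil
  show ?case using alternatingD[OF assms, of xs x y cs] by simp
next
  case (Cons b bs)
  have "c (xs @ x # (b # bs) @ y # cs) = - c ((xs @ [b]) @ x # bs @ y # cs)"
    using alternatingD[OF assms, of xs x b "bs @ y # cs"] by simp
  also have "\<dots> = c (xs @ b # y # bs @ x # cs)"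
    using Cons[of "xs @ [b]"] by simp
  also have "\<dots> = - c (xs @ y # (b # bs) @ x # cs)"
    using alternatingD[OF assms, of xs b y "bs @ x # cs"] by simp
  finally show ?case .
qed

lemma swap_decomp:
  assumes "i < j" "j < length xs"
  obtains as bs cs where "xs = as @ xs ! i # bs @ xs ! j # cs"
    and "xs[i := xs ! j, j := xs ! i] = as @ xs ! j # bs @ xs ! i # cs"
proof -
  define as where "as = take i xs"
  define bs where "bs = take (j - Suc i) (drop (Suc i) xs)"
  define cs where "cs = drop (Suc j) xs"
  have 1: "xs = as @ xs ! i # drop (Suc i) xs"
    using assms unfolding as_def by (simp add: id_take_nth_drop)
  have 2: "drop (Suc i) xs = bs @ xs ! j # cs"
    using assms id_take_nth_drop[of "j - Suc i" "drop (Suc i) xs"]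
    unfolding bs_def cs_def by simp
  have 3: "xs = as @ xs ! i # bs @ xs ! j # cs" using 1 2 by simp
  have la: "length as = i" and lb: "length bs = j - Suc i"
    using assms unfolding as_def bs_def by auto
  have "xs[i := xs ! j, j := xs ! i] = (as @ xs ! i # bs @ xs ! j # cs)[i := xs ! j, j := xs ! i]"
    using arg_cong[OF 3, of "\<lambda>l. l[i := xs ! j, j := xs ! i]"] .
  also have "\<dots> = as @ xs ! j # bs @ xs ! i # cs"
    using la lb assms by (auto simp: list_update_append split: nat.splits)
  finally have 4: "xs[i := xs ! j, j := xs ! i] = as @ xs ! j # bs @ xs ! i # cs" .
  show ?thesis by (rule that[OF 3 4])
qed

lemma alternating_iff_swap:
  "alternating c \<longleftrightarrow> (\<forall>xs i j. i < j \<and> j < length xs \<longrightarrow> c (xs[i := xs ! j, j := xs ! i]) = - c xs)"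
proof
  assume alt: "alternating c"
  show "\<forall>xs i j. i < j \<and> j < length xs \<longrightarrow> c (xs[i := xs ! j, j := xs ! i]) = - c xs"
  proof (intro allI impI)
    fix xs :: "'a list" and i j assume "i < j \<and> j < length xs"
    then obtain as bs cs where *: "xs = as @ xs ! i # bs @ xs ! j # cs"
      "xs[i := xs ! j, j := xs ! i] = as @ xs ! j # bs @ xs ! i # cs"
      by (elim conjE) (rule swap_decomp)
    have "c (as @ xs ! j # bs @ xs ! i # cs) = - c (as @ xs ! i # bs @ xs ! j # cs)"
      by (rule alternating_swap[OF alt])
    then show "c (xs[i := xs ! j, j := xs ! i]) = - c xs"
      unfolding *(2) using arg_cong[OF *(1), of c] by linarith
  qed
next
  assume R: "\<forall>xs i j. i < j \<and> j < length xs \<longrightarrow> c (xs[i := xs ! j, j := xs ! i]) = - c xs"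
  show "alternating c" unfolding alternating_def
  proof (intro allI)
    fix xs ys :: "'a list" and x y
    let ?l = "xs @ y # x # ys"
    have "?l[length xs := ?l ! Suc (length xs), Suc (length xs) := ?l ! length xs] = xs @ x # y # ys"
      by (simp add: list_update_append nth_append)
    moreover have "c (?l[length xs := ?l ! Suc (length xs), Suc (length xs) := ?l ! length xs]) = - c ?l"
      by (rule R[rule_format]) simp
    ultimately show "c (xs @ x # y # ys) = - c ?l" by simp
  qed
qed

lemma alternating_repeat:
  assumes "alternating c" "\<not> distinct xs"
  shows "c xs = 0"
proof -
  obtain as y bs cs where xs: "xs = as @ y # bs @ y # cs"
    using not_distinct_decomp[OF assms(2)] by (elim exE) simp
  have "c xs = - c xs" unfolding xs by (rule alternating_swap[OF assms(1)])
  then show ?thesis by linarith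
qed

text \<open>Alternation forces a chain to vanish on lists with repetitions, and a finite vertex set forces its
  support to be finite.\<close>
lemma oriented_chains_iff:
  assumes "finite (\<Union>K)"
  shows "c \<in> oriented_chains K n \<longleftrightarrow>
    alternating c \<and> (\<forall>xs. c xs \<noteq> 0 \<longrightarrow> set xs \<in> K \<and> int (length xs) = n + 1)"
proof -
  have fin: "finite {xs. c xs \<noteq> 0}"
    if alt: "alternating c" and s: "\<forall>xs. c xs \<noteq> 0 \<longrightarrow> set xs \<in> K \<and> int (length xs) = n + 1"
  proof (rule finite_subset)
    show "{xs. c xs \<noteq> 0} \<subseteq> {xs. set xs \<subseteq> \<Union>K \<and> length xs = nat (n + 1)}"
    proof (intro subsetI, unfold mem_Collect_eq)
      fix xs assume "c xs \<noteq> 0"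
      then have "set xs \<in> K" "int (length xs) = n + 1" using s by blast+
      then show "set xs \<subseteq> \<Union>K \<and> length xs = nat (n + 1)" by (simp add: Union_upper flip: nat_int)
    qed
    show "finite \<dots>" by (rule finite_lists_length_eq[OF assms])
  qed
  show ?thesis
  proof
    assume "c \<in> oriented_chains K n"
    then show "alternating c \<and> (\<forall>xs. c xs \<noteq> 0 \<longrightarrow> set xs \<in> K \<and> int (length xs) = n + 1)"
      unfolding oriented_chains_def ordered_simplices_def alternating_iff_swap by blast
  next
    assume *: "alternating c \<and> (\<forall>xs. c xs \<noteq> 0 \<longrightarrow> set xs \<in> K \<and> int (length xs) = n + 1)"
    then have "{xs. c xs \<noteq> 0} \<subseteq> ordered_simplices K n"
      using alternating_repeat[of c] unfolding ordered_simplices_def by blast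
    then show "c \<in> oriented_chains K n"
      using * fin unfolding oriented_chains_def alternating_iff_swap by blast
  qed
qed

lemma oriented_chainsI:
  assumes "finite (\<Union>K)" "alternating c"
    and "\<And>xs. c xs \<noteq> 0 \<Longrightarrow> set xs \<in> K \<and> int (length xs) = n + 1"
  shows "c \<in> oriented_chains K n"
  using assms oriented_chains_iff by blast

lemma oriented_chains_alternating: "c \<in> oriented_chains K n \<Longrightarrow> alternating c"
  unfolding oriented_chains_def alternating_iff_swap by blast

lemma oriented_chains_support:
  assumes "c \<in> oriented_chains K n" "c xs \<noteq> 0"
  shows "set xs \<in> K" "int (length xs) = n + 1" "distinct xs"
  using assms unfolding oriented_chains_def ordered_simplices_def by blast+

lemma oriented_chains_add:
  assumes "finite (\<Union>K)" "c \<in> oriented_chains K n" "d \<in> oriented_chains K n"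
  shows "(\<lambda>xs. c xs + d xs) \<in> oriented_chains K n"
proof (rule oriented_chainsI[OF assms(1)])
  show "alternating (\<lambda>xs. c xs + d xs)"
    using assms unfolding oriented_chains_iff[OF assms(1)] alternating_def
    by (metis minus_add_distrib)
  fix xs assume "c xs + d xs \<noteq> 0"
  then have "c xs \<noteq> 0 \<or> d xs \<noteq> 0" by auto
  then show "set xs \<in> K \<and> int (length xs) = n + 1"
    using assms unfolding oriented_chains_iff[OF assms(1)] by blast
qed

lemma oriented_chains_uminus:
  assumes "finite (\<Union>K)" "c \<in> oriented_chains K n"
  shows "(\<lambda>xs. - c xs) \<in> oriented_chains K n"
  using assms(2) unfolding oriented_chains_iff[OF assms(1)] neg_equal_0_iff_equal
  by (metis (no_types, lifting) alternating_def)

lemma oriented_chains_zero: "(\<lambda>_. 0) \<in> oriented_chains K n"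
  unfolding oriented_chains_def by auto

lemma oriented_chains_mono:
  assumes "K \<subseteq> K'" shows "oriented_chains K n \<subseteq> oriented_chains K' n"
  using assms unfolding oriented_chains_def ordered_simplices_def by blast

lemma boundary_eq_sum:
  assumes "finite V" "\<And>y. c (y # xs) \<noteq> 0 \<Longrightarrow> y \<in> V"
  shows "boundary c xs = (\<Sum>y\<in>V. c (y # xs))"
  unfolding boundary_def
  by (rule sum.mono_neutral_left[OF assms(1)]) (use assms(2) in auto)

lemma boundary_chain_eq_sum:
  assumes "finite V" "\<Union>K \<subseteq> V" "c \<in> oriented_chains K n"
  shows "boundary c = (\<lambda>xs. \<Sum>y\<in>V. c (y # xs))"
proof
  fix xs
  have "finite (\<Union>K)" using assms finite_subset by blast
  then show "boundary c xs = (\<Sum>y\<in>V. c (y # xs))"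
  proof (intro boundary_eq_sum[OF assms(1)])
    fix y assume "c (y # xs) \<noteq> 0"
    then have "set (y # xs) \<in> K" by (rule oriented_chains_support(1)[OF assms(3)])
    then show "y \<in> V" using assms(2) by auto
  qed
qed

text \<open>The cone is exterior multiplication by \<open>v\<close>: written as a signed insertion it would need
  positions in a list, whereas the Leibniz rule for the contraction with the head \<open>x\<close> determines it
  by recursion.\<close>
fun cone :: "'v \<Rightarrow> ('v list \<Rightarrow> int) \<Rightarrow> 'v list \<Rightarrow> int" where
  "cone v c [] = 0"
| "cone v c (x # xs) = (if x = v then c xs else 0) - cone v (\<lambda>zs. c (x # zs)) xs"

lemma cone_zero [simp]: "cone v (\<lambda>_. 0) ys = 0"
  by (induction ys) auto

lemma cone_add: "cone v (\<lambda>xs. c xs + d xs) ys = cone v c ys + cone v d ys"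
  by (induction ys arbitrary: c d) auto

lemma cone_uminus: "cone v (\<lambda>xs. - c xs) ys = - cone v c ys"
  by (induction ys arbitrary: c) auto

lemma cone_sum: "cone v (\<lambda>xs. \<Sum>y\<in>A. f y xs) ys = (\<Sum>y\<in>A. cone v (f y) ys)"
  by (induction ys arbitrary: f) (auto simp: sum_subtractf)

lemma cone_nonzeroD:
  "cone v c ys \<noteq> 0 \<Longrightarrow> \<exists>a b. ys = a @ v # b \<and> c (a @ b) \<noteq> 0"
proof (induction ys arbitrary: c)
  case (Cons x xs)
  show ?case
  proof (cases "x = v \<and> c xs \<noteq> 0")
    case True
    then show ?thesis by (intro exI[of _ "[]"] exI[of _ xs]) simp
  next
    case False
    then have "cone v (\<lambda>zs. c (x # zs)) xs \<noteq> 0" using Cons.prems by (auto split: if_splits)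
    then obtain a b where "xs = a @ v # b" "c (x # a @ b) \<noteq> 0" using Cons.IH by blast
    then show ?thesis by (intro exI[of _ "x # a"] exI[of _ b]) simp
  qed
qed simp

lemma alternating_Cons: "alternating c \<Longrightarrow> alternating (\<lambda>zs. c (x # zs))"
  unfolding alternating_def by (metis append.simps(2))

lemma alternating_cone:
  assumes "alternating c"
  shows "alternating (cone v c)"
proof -
  have "cone v c (xs @ x # y # ys) = - cone v c (xs @ y # x # ys)" for xs x y ys
    using assms
  proof (induction xs arbitrary: c)
    case Nil
    have "(\<lambda>zs. c (x # y # zs)) = (\<lambda>zs. - c (y # x # zs))"
      using alternatingD[OF Nil, of "[]" x y] by (intro ext) simp
    then show ?case by (simp add: cone_uminus)
  next
    case (Cons z zs)
    then show ?case
      using alternatingD[OF Cons.prems, of zs x y ys] Cons.IH[OF alternating_Cons[OF Cons.prems, of z]]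
      by simp
  qed
  then show ?thesis unfolding alternating_def by blast
qed

lemma cone_chain:
  assumes "finite (\<Union>K)" "finite (\<Union>K')" "\<And>F. F \<in> K \<Longrightarrow> insert v F \<in> K'"
    and "c \<in> oriented_chains K (n - 1)"
  shows "cone v c \<in> oriented_chains K' n"
proof (rule oriented_chainsI[OF assms(2)])
  show "alternating (cone v c)"
    by (rule alternating_cone[OF oriented_chains_alternating[OF assms(4)]])
  fix xs assume "cone v c xs \<noteq> 0"
  then obtain a b where ab: "xs = a @ v # b" "c (a @ b) \<noteq> 0" using cone_nonzeroD by metis
  have "set (a @ b) \<in> K" "int (length (a @ b)) = n"
    using oriented_chains_support(1,2)[OF assms(4) ab(2)] by simp_all
  moreover have "set xs = insert v (set (a @ b))" using ab by auto
  ultimately show "set xs \<in> K' \<and> int (length xs) = n + 1"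
    using assms(3)[of "set (a @ b)"] ab(1) by simp
qed

text \<open>The boundary is contraction with the sum of all dual vertices, so the Leibniz rule built into
  the cone gives the homotopy formula \<open>\<partial>(v * c) = c - v * \<partial>c\<close> by linearity.\<close>
lemma boundary_cone:
  assumes "finite V" "v \<in> V" "\<Union>K \<subseteq> V" "c \<in> oriented_chains K n" "\<Union>K' \<subseteq> V"
    "cone v c \<in> oriented_chains K' m"
  shows "boundary (cone v c) xs = c xs - cone v (boundary c) xs"
proof -
  have "boundary (cone v c) xs = (\<Sum>y\<in>V. cone v c (y # xs))"
    using boundary_chain_eq_sum[OF assms(1,5,6)] by simp
  also have "\<dots> = c xs - (\<Sum>y\<in>V. cone v (\<lambda>zs. c (y # zs)) xs)"
    using assms(1,2) by (simp add: sum_subtractf sum.delta)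
  also have "\<dots> = c xs - cone v (boundary c) xs"
    by (simp add: boundary_chain_eq_sum[OF assms(1,3,4)] cone_sum)
  finally show ?thesis .
qed

text \<open>On the simplices that contain \<open>v\<close>, a chain is determined by its link at \<open>v\<close>: move \<open>v\<close> to the
  front.\<close>
lemma cone_link:
  assumes "alternating d" "distinct xs" "v \<in> set xs"
  shows "cone v (\<lambda>zs. d (v # zs)) xs = d xs"
  using assms
proof (induction xs arbitrary: d)
  case (Cons x xs)
  show ?case
  proof (cases "x = v")
    case True
    have "(\<lambda>zs. d (v # v # zs)) = (\<lambda>_. 0)"
      using alternatingD[OF Cons.prems(1), of "[]" v v] by (intro ext) (metis append_Nil equal_neg_zero)
    then show ?thesis using True by simp
  next
    case False
    have "(\<lambda>zs. d (v # x # zs)) = (\<lambda>zs. - d (x # v # zs))"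
      using alternatingD[OF Cons.prems(1), of "[]" v x] by (intro ext) simp
    moreover have "cone v (\<lambda>zs. d (x # v # zs)) xs = d (x # xs)"
      using Cons.IH[OF alternating_Cons[OF Cons.prems(1), of x]] Cons.prems False by auto
    ultimately show ?thesis using False by (simp add: cone_uminus)
  qed
qed simp

lemma boundary_link:
  assumes "finite (\<Union>K)" "c \<in> oriented_chains K n"
  shows "boundary (\<lambda>zs. c (v # zs)) xs = - boundary c (v # xs)"
proof -
  note alt = oriented_chains_alternating[OF assms(2)]
  note s = oriented_chains_support(1)[OF assms(2)]
  have sw: "c (v # y # xs) = - c (y # v # xs)" for y
    using alternatingD[OF alt, of "[]" v y xs] by simp
  have "boundary (\<lambda>zs. c (v # zs)) xs = (\<Sum>y\<in>\<Union>K. c (v # y # xs))"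
    by (rule boundary_eq_sum[OF assms(1)]) (use s[THEN Union_upper] in force)
  also have "\<dots> = - (\<Sum>y\<in>\<Union>K. c (y # v # xs))" by (simp add: sw sum_negf)
  also have "(\<Sum>y\<in>\<Union>K. c (y # v # xs)) = boundary c (v # xs)"
    by (rule boundary_eq_sum[OF assms(1), symmetric]) (use s[THEN Union_upper] in force)
  finally show ?thesis .
qed

lemma boundary_chain:
  assumes "finite (\<Union>K)" "\<And>F G. F \<in> K \<Longrightarrow> G \<subseteq> F \<Longrightarrow> G \<in> K" "c \<in> oriented_chains K n"
  shows "boundary c \<in> oriented_chains K (n - 1)"
proof (rule oriented_chainsI[OF assms(1)])
  have bd: "boundary c = (\<lambda>xs. \<Sum>y\<in>\<Union>K. c (y # xs))"
    using boundary_chain_eq_sum assms by blast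
  note c = oriented_chains_alternating[OF assms(3)]
  show "alternating (boundary c)"
    unfolding bd alternating_def sum_negf[symmetric]
    by (intro allI sum.cong refl) (use alternatingD[OF alternating_Cons[OF c]] in blast)
  fix xs assume "boundary c xs \<noteq> 0"
  then obtain y where "c (y # xs) \<noteq> 0" unfolding bd by (meson sum.not_neutral_contains_not_neutral)
  from oriented_chains_support(1,2)[OF assms(3) this]
  show "set xs \<in> K \<and> int (length xs) = n - 1 + 1"
    using assms(2)[of "set (y # xs)" "set xs"] by auto
qed

lemma boundary_boundary:
  assumes "finite (\<Union>K)" "\<And>F G. F \<in> K \<Longrightarrow> G \<subseteq> F \<Longrightarrow> G \<in> K" "c \<in> oriented_chains K n"
  shows "boundary (boundary c) = (\<lambda>_. 0)"
proof
  fix xs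
  let ?V = "\<Union>K"
  note alt = oriented_chains_alternating[OF assms(3)]
  have "boundary (boundary c) xs = (\<Sum>x\<in>?V. \<Sum>y\<in>?V. c (y # x # xs))"
    using boundary_chain_eq_sum[OF assms(1) order_refl boundary_chain[OF assms]]
      boundary_chain_eq_sum[OF assms(1) order_refl assms(3)] by simp
  moreover have "(\<Sum>x\<in>?V. \<Sum>y\<in>?V. c (y # x # xs)) = (\<Sum>x\<in>?V. \<Sum>y\<in>?V. - c (x # y # xs))"
    by (intro sum.cong refl) (rule alternatingD[OF alt, of "[]" _ _ xs, unfolded append_Nil])
  moreover have "(\<Sum>x\<in>?V. \<Sum>y\<in>?V. c (x # y # xs)) = (\<Sum>x\<in>?V. \<Sum>y\<in>?V. c (y # x # xs))"
    by (rule sum.swap)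
  ultimately show "boundary (boundary c) xs = 0" unfolding sum_negf by linarith
qed

lemma boundary_add:
  assumes "finite (\<Union>K)" "c \<in> oriented_chains K n" "d \<in> oriented_chains K n"
  shows "boundary (\<lambda>xs. c xs + d xs) = (\<lambda>xs. boundary c xs + boundary d xs)"
  using boundary_chain_eq_sum[OF assms(1) order_refl oriented_chains_add[OF assms]]
    boundary_chain_eq_sum[OF assms(1) order_refl assms(2)]
    boundary_chain_eq_sum[OF assms(1) order_refl assms(3)] by (simp add: sum.distrib)

lemma boundary_uminus: "boundary (\<lambda>xs. - c xs) = (\<lambda>xs. - boundary c xs)"
  unfolding boundary_def by (simp add: sum_negf)

lemma cycles_iff: "c \<in> cycles K n \<longleftrightarrow> c \<in> oriented_chains K n \<and> boundary c = (\<lambda>_. 0)"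
  unfolding cycles_def kernel_def chain_group_def by auto

lemma boundaries_eq: "boundaries K n = boundary ` oriented_chains K (n + 1)"
  unfolding boundaries_def chain_group_def by simp

lemma boundaries_subset_cycles:
  assumes "finite (\<Union>K)" "\<And>F G. F \<in> K \<Longrightarrow> G \<subseteq> F \<Longrightarrow> G \<in> K"
  shows "boundaries K n \<subseteq> cycles K n"
  unfolding boundaries_eq
  using boundary_chain[OF assms, where n = "n + 1"] boundary_boundary[OF assms, where n = "n + 1"]
  by (auto simp: cycles_iff)

lemma oriented_chains_diff:
  assumes "finite (\<Union>K)" "c \<in> oriented_chains K n" "d \<in> oriented_chains K n"
  shows "(\<lambda>xs. c xs - d xs) \<in> oriented_chains K n"
  using oriented_chains_add[OF assms(1,2) oriented_chains_uminus[OF assms(1,3)]] by simp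

lemma boundary_diff:
  assumes "finite (\<Union>K)" "c \<in> oriented_chains K n" "d \<in> oriented_chains K n"
  shows "boundary (\<lambda>xs. c xs - d xs) = (\<lambda>xs. boundary c xs - boundary d xs)"
  using boundary_add[OF assms(1,2) oriented_chains_uminus[OF assms(1,3)]]
  by (simp add: boundary_uminus)

section \<open>Adding a dominated vertex\<close>

text \<open>The isomorphism of the homology group with \<open>\<int>\<^sup>r\<close> is given on cycles instead of classes,
  so that the inductive steps can be made on chains without cosets; the vectors
  of \<open>\<int>\<^sup>r\<close> are the functions on the natural numbers that vanish from \<open>r\<close> on.\<close>
definition free_homology :: "'v set set \<Rightarrow> int \<Rightarrow> nat \<Rightarrow> bool" where
  "free_homology K n r \<longleftrightarrow> (\<exists>\<phi> :: ('v list \<Rightarrow> int) \<Rightarrow> nat \<Rightarrow> int.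
     (\<forall>c\<in>cycles K n. \<forall>d\<in>cycles K n. \<phi> (\<lambda>xs. c xs + d xs) = (\<lambda>i. \<phi> c i + \<phi> d i)) \<and>
     \<phi> ` cycles K n = {f. \<forall>i\<ge>r. f i = 0} \<and>
     {c \<in> cycles K n. \<phi> c = (\<lambda>_. 0)} = boundaries K n)"

text \<open>\<open>D\<close> and \<open>L\<close> are the deletion and the link of \<open>v\<close>. Topologically, \<open>K\<close> is \<open>D\<close> with a cone over \<open>L\<close>
  attached. Domination says that \<open>D\<close> already contains the cone from \<open>w\<close> over \<open>L\<close>, so \<open>L\<close> is
  contractible in \<open>D\<close> and \<open>K\<close> is, up to homotopy, the wedge of \<open>D\<close> and the suspension of \<open>L\<close>. The maps below make this
  explicit: a chain \<open>c\<close> of \<open>K\<close> is the sum of \<open>retract c\<close>, a chain of \<open>D\<close>, and of the suspension of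
  \<open>link c\<close> with the two poles \<open>v\<close> and \<open>w\<close>.\<close>
locale dominated_vertex =
  fixes K D L :: "'v set set" and v w :: 'v
  assumes fin: "finite (\<Union>K)"
    and down: "\<And>F G. F \<in> K \<Longrightarrow> G \<subseteq> F \<Longrightarrow> G \<in> K"
    and v_in: "{v} \<in> K"
    and D_def: "D = {F \<in> K. v \<notin> F}"
    and L_def: "L = {F. v \<notin> F \<and> insert v F \<in> K}"
    and dom: "\<And>F. F \<in> L \<Longrightarrow> insert w F \<in> D"
begin

definition link :: "('v list \<Rightarrow> int) \<Rightarrow> 'v list \<Rightarrow> int" where
  "link c = (\<lambda>zs. c (v # zs))"

definition suspend :: "('v list \<Rightarrow> int) \<Rightarrow> 'v list \<Rightarrow> int" where
  "suspend l = (\<lambda>xs. cone v l xs - cone w l xs)"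

definition retract :: "('v list \<Rightarrow> int) \<Rightarrow> 'v list \<Rightarrow> int" where
  "retract c = (\<lambda>xs. c xs - suspend (link c) xs)"

lemma D_sub: "D \<subseteq> K" and L_sub: "L \<subseteq> K"
  using down unfolding D_def L_def by auto

lemma finD: "finite (\<Union>D)" and finL: "finite (\<Union>L)"
  using fin D_sub L_sub Union_mono finite_subset by metis+

lemma v_K: "v \<in> \<Union>K" and w_K: "w \<in> \<Union>K"
proof -
  show "v \<in> \<Union>K" using v_in by blast
  have "{} \<in> L" using v_in unfolding L_def by simp
  then show "w \<in> \<Union>K" using dom D_sub by blast
qed

lemma chains_D_K: "c \<in> oriented_chains D n \<Longrightarrow> c \<in> oriented_chains K n"
  using oriented_chains_mono[OF D_sub] by blast

lemma link_chain:
  assumes "c \<in> oriented_chains K n" shows "link c \<in> oriented_chains L (n - 1)"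
proof (rule oriented_chainsI[OF finL])
  show "alternating (link c)"
    unfolding link_def by (rule alternating_Cons[OF oriented_chains_alternating[OF assms]])
  fix xs assume "link c xs \<noteq> 0"
  then show "set xs \<in> L \<and> int (length xs) = n - 1 + 1"
    using oriented_chains_support[OF assms, of "v # xs"] unfolding link_def L_def by auto
qed

lemma cone_v_chain:
  assumes "l \<in> oriented_chains L (n - 1)" shows "cone v l \<in> oriented_chains K n"
  by (rule cone_chain[OF finL fin _ assms]) (simp add: L_def)

lemma cone_w_chain:
  assumes "l \<in> oriented_chains L (n - 1)" shows "cone w l \<in> oriented_chains D n"
  by (rule cone_chain[OF finL finD dom assms])

lemma suspend_chain:
  assumes "l \<in> oriented_chains L (n - 1)" shows "suspend l \<in> oriented_chains K n"
  unfolding suspend_def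
  by (rule oriented_chains_diff[OF fin cone_v_chain[OF assms] chains_D_K[OF cone_w_chain[OF assms]]])

lemma chain_D_zero:
  assumes "c \<in> oriented_chains D n" "v \<in> set xs" shows "c xs = 0"
  using oriented_chains_support(1)[OF assms(1), of xs] assms(2) unfolding D_def by auto

lemma link_D: "c \<in> oriented_chains D n \<Longrightarrow> link c = (\<lambda>_. 0)"
  unfolding link_def using chain_D_zero by fastforce

lemma link_suspend:
  assumes "l \<in> oriented_chains L (n - 1)" shows "link (suspend l) = l"
proof -
  have "(\<lambda>zs. l (v # zs)) = (\<lambda>_. 0)"
    using oriented_chains_support(1)[OF assms] unfolding L_def by fastforce
  then have "cone v l (v # zs) = l zs" for zs by simp
  moreover have "cone w l (v # zs) = 0" for zs
    by (rule chain_D_zero[OF cone_w_chain[OF assms]]) simp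
  ultimately show ?thesis unfolding link_def suspend_def by (intro ext) (simp only: diff_zero)
qed

lemma retract_chain:
  assumes c: "c \<in> oriented_chains K n" shows "retract c \<in> oriented_chains D n"
proof (rule oriented_chainsI[OF finD])
  have pK: "retract c \<in> oriented_chains K n"
    unfolding retract_def by (rule oriented_chains_diff[OF fin c suspend_chain[OF link_chain[OF c]]])
  show "alternating (retract c)" by (rule oriented_chains_alternating[OF pK])
  fix xs assume nz: "retract c xs \<noteq> 0"
  note s = oriented_chains_support[OF pK nz]
  have "v \<notin> set xs"
  proof
    assume v: "v \<in> set xs"
    have "cone v (link c) xs = c xs"
      unfolding link_def by (rule cone_link[OF oriented_chains_alternating[OF c] s(3) v])
    moreover have "cone w (link c) xs = 0"
      by (rule chain_D_zero[OF cone_w_chain[OF link_chain[OF c]] v])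
    ultimately show False using nz unfolding retract_def suspend_def by simp
  qed
  then show "set xs \<in> D \<and> int (length xs) = n + 1" using s unfolding D_def by simp
qed

lemma suspend_add: "suspend (\<lambda>xs. c xs + d xs) = (\<lambda>xs. suspend c xs + suspend d xs)"
  unfolding suspend_def by (intro ext) (simp add: cone_add)

lemma suspend_uminus: "suspend (\<lambda>xs. - c xs) = (\<lambda>xs. - suspend c xs)"
  unfolding suspend_def by (simp add: cone_uminus)

lemma suspend_zero: "suspend (\<lambda>_. 0) = (\<lambda>_. 0)"
  unfolding suspend_def by simp

lemma boundary_suspend:
  assumes l: "l \<in> oriented_chains L (n - 1)"
  shows "boundary (suspend l) = (\<lambda>xs. - suspend (boundary l) xs)"
proof
  fix xs
  have LK: "\<Union>L \<subseteq> \<Union>K" using L_sub by blast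
  have "boundary (suspend l) xs = boundary (cone v l) xs - boundary (cone w l) xs"
    unfolding suspend_def
    using boundary_diff[OF fin cone_v_chain[OF l] chains_D_K[OF cone_w_chain[OF l]]] by metis
  also have "boundary (cone v l) xs = l xs - cone v (boundary l) xs"
    by (rule boundary_cone[OF fin v_K LK l order_refl cone_v_chain[OF l]])
  also have "boundary (cone w l) xs = l xs - cone w (boundary l) xs"
    by (rule boundary_cone[OF fin w_K LK l order_refl chains_D_K[OF cone_w_chain[OF l]]])
  finally show "boundary (suspend l) xs = - suspend (boundary l) xs" unfolding suspend_def by simp
qed

lemma boundary_link_chain:
  assumes "c \<in> oriented_chains K n" shows "link (boundary c) = (\<lambda>xs. - boundary (link c) xs)"
  unfolding link_def using boundary_link[OF fin assms, of v] by simp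

lemma boundary_retract:
  assumes c: "c \<in> oriented_chains K n" shows "boundary (retract c) = retract (boundary c)"
proof -
  have "boundary (retract c) = (\<lambda>xs. boundary c xs - boundary (suspend (link c)) xs)"
    unfolding retract_def by (rule boundary_diff[OF fin c suspend_chain[OF link_chain[OF c]]])
  then show ?thesis
    unfolding retract_def boundary_link_chain[OF c] suspend_uminus boundary_suspend[OF link_chain[OF c]] by simp
qed

lemma retract_cycle: "c \<in> cycles K n \<Longrightarrow> retract c \<in> cycles D n"
  unfolding cycles_iff using retract_chain boundary_retract
  by (fastforce simp: retract_def link_def suspend_zero)

lemma link_cycle: 
  assumes "c \<in> cycles K n" shows "link c \<in> cycles L (n - 1)"
proof -
  have c: "c \<in> oriented_chains K n" "boundary c = (\<lambda>_. 0)" using assms cycles_iff by blast+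
  have "boundary (link c) xs = 0" for xs
    using fun_cong[OF boundary_link_chain[OF c(1)], of xs] c(2) unfolding link_def by simp
  then show ?thesis unfolding cycles_iff using link_chain[OF c(1)] by auto
qed

text \<open>The decomposition of chains commutes with the boundary up to a sign on the link, so it splits
  cycles and boundaries alike.\<close>
lemma free_homology_add:
  assumes "free_homology D n r" "free_homology L (n - 1) s"
  shows "free_homology K n (r + s)"
proof -
  obtain f :: "('v list \<Rightarrow> int) \<Rightarrow> nat \<Rightarrow> int" where f': "(\<forall>c\<in>cycles D n. \<forall>d\<in>cycles D n. f (\<lambda>xs. c xs + d xs) = (\<lambda>i. f c i + f d i)) \<and>
      f ` cycles D n = {f. \<forall>i\<ge>r. f i = 0} \<and>
      {c \<in> cycles D n. f c = (\<lambda>_. 0)} = boundaries D n"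
    using assms(1) unfolding free_homology_def by (elim exE)
  then have f: "\<And>c d. c \<in> cycles D n \<Longrightarrow> d \<in> cycles D n \<Longrightarrow> f (\<lambda>xs. c xs + d xs) = (\<lambda>i. f c i + f d i)"
    "f ` cycles D n = {f. \<forall>i\<ge>r. f i = 0}" "{c \<in> cycles D n. f c = (\<lambda>_. 0)} = boundaries D n"
    by simp_all
  obtain g :: "('v list \<Rightarrow> int) \<Rightarrow> nat \<Rightarrow> int" where g': "(\<forall>c\<in>cycles L (n-1). \<forall>d\<in>cycles L (n-1). g (\<lambda>xs. c xs + d xs) = (\<lambda>i. g c i + g d i)) \<and>
      g ` cycles L (n-1) = {f. \<forall>i\<ge>s. f i = 0} \<and>
      {c \<in> cycles L (n-1). g c = (\<lambda>_. 0)} = boundaries L (n-1)"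
    using assms(2) unfolding free_homology_def by (elim exE)
  then have g: "\<And>c d. c \<in> cycles L (n-1) \<Longrightarrow> d \<in> cycles L (n-1) \<Longrightarrow> g (\<lambda>xs. c xs + d xs) = (\<lambda>i. g c i + g d i)"
    "g ` cycles L (n-1) = {f. \<forall>i\<ge>s. f i = 0}" "{c \<in> cycles L (n-1). g c = (\<lambda>_. 0)} = boundaries L (n-1)"
    by simp_all
  \<comment> \<open>coordinates below \<open>r\<close> come from the deletion, the following \<open>s\<close> ones from the link\<close>
  define h where "h c i = (if i < r then f (retract c) i else g (link c) (i - r))" for c i
  have add: "h (\<lambda>xs. c xs + d xs) = (\<lambda>i. h c i + h d i)" if "c \<in> cycles K n" "d \<in> cycles K n" for c d
  proof -
    have "retract (\<lambda>xs. c xs + d xs) = (\<lambda>xs. retract c xs + retract d xs)"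
      unfolding retract_def link_def by (intro ext) (simp add: suspend_add)
    moreover have "link (\<lambda>xs. c xs + d xs) = (\<lambda>xs. link c xs + link d xs)" unfolding link_def by simp
    ultimately show ?thesis
      unfolding h_def using that f(1)[OF retract_cycle retract_cycle] g(1)[OF link_cycle link_cycle] by (intro ext) simp
  qed
  have decomp: "c = (\<lambda>xs. retract c xs + suspend (link c) xs)" for c unfolding retract_def by simp
  have img: "h ` cycles K n = {f. \<forall>i\<ge>r + s. f i = 0}"
  proof (intro equalityI subsetI)
    fix y assume "y \<in> h ` cycles K n"
    then obtain c where c: "c \<in> cycles K n" "y = h c" by blast
    then have "g (link c) \<in> {f. \<forall>i\<ge>s. f i = 0}" using g(2) link_cycle by blast
    then show "y \<in> {f. \<forall>i\<ge>r + s. f i = 0}" unfolding c h_def by auto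
  next
    fix y :: "nat \<Rightarrow> int" assume y: "y \<in> {f. \<forall>i\<ge>r + s. f i = 0}"
    have "(\<lambda>i. if i < r then y i else 0) \<in> f ` cycles D n" unfolding f(2) by simp
    then obtain a where a: "(\<lambda>i. if i < r then y i else 0) = f a" "a \<in> cycles D n" by (rule imageE)
    have "(\<lambda>i. y (i + r)) \<in> g ` cycles L (n-1)" unfolding g(2) using y by simp
    then obtain l where l: "(\<lambda>i. y (i + r)) = g l" "l \<in> cycles L (n-1)" by (rule imageE)
    have aD: "a \<in> oriented_chains D n" "boundary a = (\<lambda>_. 0)" using a(2) cycles_iff by blast+
    have lL: "l \<in> oriented_chains L (n - 1)" "boundary l = (\<lambda>_. 0)" using l(2) cycles_iff by blast+
    define c where "c = (\<lambda>xs. a xs + suspend l xs)"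
    have "boundary c = (\<lambda>_. 0)"
      unfolding c_def boundary_add[OF fin chains_D_K[OF aD(1)] suspend_chain[OF lL(1)]]
        boundary_suspend[OF lL(1)] aD(2) lL(2) suspend_zero by simp
    then have cK: "c \<in> cycles K n"
      unfolding cycles_iff c_def
      using oriented_chains_add[OF fin chains_D_K[OF aD(1)] suspend_chain[OF lL(1)]] by simp
    have link: "link c = l"
      using fun_cong[OF link_D[OF aD(1)]] fun_cong[OF link_suspend[OF lL(1)]] unfolding c_def link_def by auto
    then have pr: "retract c = a" unfolding retract_def c_def by simp
    have "h c = y" unfolding h_def link pr a(1)[symmetric] l(1)[symmetric] using y by auto
    then show "y \<in> h ` cycles K n" using cK by blast
  qed
  have ker_iff: "h c = (\<lambda>_. 0) \<longleftrightarrow> retract c \<in> boundaries D n \<and> link c \<in> boundaries L (n-1)"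
    if c: "c \<in> cycles K n" for c
  proof -
    have "f (retract c) \<in> {f. \<forall>i\<ge>r. f i = 0}" using f(2) retract_cycle[OF c] by blast
    then have fz: "f (retract c) i = 0" if "i \<ge> r" for i using that by blast
    have "h c = (\<lambda>_. 0) \<longleftrightarrow> f (retract c) = (\<lambda>_. 0) \<and> g (link c) = (\<lambda>_. 0)"
    proof
      assume h: "h c = (\<lambda>_. 0)"
      have "f (retract c) i = 0" for i
        using fun_cong[OF h, of i] fz[of i] unfolding h_def by (cases "i < r") auto
      moreover have "g (link c) i = 0" for i
        using fun_cong[OF h, of "i + r"] unfolding h_def by simp
      ultimately show "f (retract c) = (\<lambda>_. 0) \<and> g (link c) = (\<lambda>_. 0)" by blast
    qed (auto simp: h_def)
    then show ?thesis using f(3) g(3) retract_cycle[OF c] link_cycle[OF c] by blast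
  qed
  have bd_iff: "c \<in> boundaries K n \<longleftrightarrow> retract c \<in> boundaries D n \<and> link c \<in> boundaries L (n-1)"
    if c: "c \<in> cycles K n" for c
  proof
    assume "c \<in> boundaries K n"
    then obtain e where e: "e \<in> oriented_chains K (n + 1)" "c = boundary e"
      unfolding boundaries_eq by blast
    have "retract c = boundary (retract e)" using boundary_retract[OF e(1)] e(2) by simp
    then have "retract c \<in> boundaries D n" unfolding boundaries_eq using retract_chain[OF e(1)] by blast
    moreover have "link c = boundary (\<lambda>xs. - link e xs)"
      unfolding e(2) boundary_link_chain[OF e(1)] boundary_uminus ..
    then have "link c \<in> boundaries L (n-1)"
      unfolding boundaries_eq using oriented_chains_uminus[OF finL link_chain[OF e(1)]] by simp
    ultimately show "retract c \<in> boundaries D n \<and> link c \<in> boundaries L (n-1)" ..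
  next
    assume "retract c \<in> boundaries D n \<and> link c \<in> boundaries L (n-1)"
    then obtain a l where a: "a \<in> oriented_chains D (n + 1)" "retract c = boundary a"
      and l: "l \<in> oriented_chains L ((n + 1) - 1)" "link c = boundary l"
      unfolding boundaries_eq by auto
    have "c = (\<lambda>xs. boundary a xs + suspend (boundary l) xs)"
      using decomp[of c] unfolding a(2) l(2) .
    also have "\<dots> = (\<lambda>xs. boundary a xs - boundary (suspend l) xs)"
      unfolding boundary_suspend[OF l(1)] by simp
    also have "\<dots> = boundary (\<lambda>xs. a xs - suspend l xs)"
      by (rule boundary_diff[OF fin chains_D_K[OF a(1)] suspend_chain[OF l(1)], symmetric])
    finally show "c \<in> boundaries K n"
      unfolding boundaries_eq
      using oriented_chains_diff[OF fin chains_D_K[OF a(1)] suspend_chain[OF l(1)]] by blast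
  qed
  have "boundaries K n \<subseteq> cycles K n" by (rule boundaries_subset_cycles[OF fin]) (rule down)
  then have "{c \<in> cycles K n. h c = (\<lambda>_. 0)} = boundaries K n"
    using ker_iff bd_iff by blast
  then show ?thesis unfolding free_homology_def using add img by blast
qed

end

lemma free_homology_acyclic:
  assumes "cycles K n = boundaries K n"
  shows "free_homology K n 0"
proof -
  have "(\<lambda>_. 0) \<in> cycles K n"
    unfolding cycles_iff by (simp add: oriented_chains_zero boundary_def)
  then show ?thesis
    unfolding free_homology_def using assms by (intro exI[of _ "\<lambda>_ _. 0"]) auto
qed

text \<open>The cone from \<open>x\<close> is a contracting homotopy; it makes sense on all of \<open>K\<close> because the cone of
  an alternating chain vanishes on lists that repeat \<open>x\<close>.\<close>
lemma free_homology_cone: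
  assumes fin: "finite (\<Union>K)" and down: "\<And>F G. F \<in> K \<Longrightarrow> G \<subseteq> F \<Longrightarrow> G \<in> K"
    and "K \<noteq> {}" and x: "\<And>F. F \<in> K \<Longrightarrow> insert x F \<in> K"
  shows "free_homology K n 0"
proof (rule free_homology_acyclic, rule equalityI)
  show "boundaries K n \<subseteq> cycles K n" by (rule boundaries_subset_cycles[OF fin down])
  show "cycles K n \<subseteq> boundaries K n"
  proof
    fix c assume "c \<in> cycles K n"
    then have c: "c \<in> oriented_chains K n" "boundary c = (\<lambda>_. 0)" using cycles_iff by blast+
    have cx: "cone x c \<in> oriented_chains K (n + 1)"
      by (rule cone_chain[where K = K, OF fin fin]) (simp_all add: x c(1))
    have "x \<in> \<Union>K" using x \<open>K \<noteq> {}\<close> by blast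
    then have "boundary (cone x c) xs = c xs" for xs
      using boundary_cone[OF fin _ order_refl c(1) order_refl cx, of xs] c(2) by simp
    then have "c = boundary (cone x c)" by (intro ext) simp
    then show "c \<in> boundaries K n" unfolding boundaries_eq by (rule image_eqI[OF _ cx])
  qed
qed

lemma free_homology_below:
  assumes "n < -1" shows "free_homology K n 0"
proof (rule free_homology_acyclic)
  have 1: "oriented_chains K n = {\<lambda>_. 0}"
  proof (intro equalityI subsetI)
    fix c assume c: "c \<in> oriented_chains K n"
    have "c xs = 0" for xs
      using oriented_chains_support(2)[OF c, of xs] assms by force
    then show "c \<in> {\<lambda>_. 0}" by auto
  qed (simp add: oriented_chains_zero)
  have "boundary c = (\<lambda>_. 0)" if "c \<in> oriented_chains K (n + 1)" for c
  proof -
    have "c (v # xs) = 0" for v xs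
      using oriented_chains_support(2)[OF that, of "v # xs"] assms by auto
    then show ?thesis unfolding boundary_def by simp
  qed
  then have "boundaries K n \<subseteq> {\<lambda>_. 0}" unfolding boundaries_eq by blast
  moreover have "(\<lambda>_. 0) \<in> boundaries K n"
    unfolding boundaries_eq by (rule image_eqI[OF _ oriented_chains_zero]) (simp add: boundary_def)
  moreover have "cycles K n = {\<lambda>_. 0}"
    unfolding set_eq_iff cycles_iff 1 by (auto simp: boundary_def)
  ultimately show "cycles K n = boundaries K n" by (intro equalityI) simp_all
qed

text \<open>The complex of the empty simplex alone is the \<open>-1\<close>-sphere. It ends the
  recursion on links, and its homology corresponds to the empty partition of the empty set.\<close>
lemma free_homology_empty_simplex:
  "free_homology {{} :: 'v set} n (if n = -1 then 1 else 0)"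
proof -
  have supp: "xs = [] \<and> n = - 1" if "c \<in> oriented_chains {{}} n" "c xs \<noteq> 0" for n c and xs :: "'v list"
    using oriented_chains_support(1,2)[OF that] by auto
  have bd: "boundary c = (\<lambda>_. 0)" if "c \<in> oriented_chains {{}::'v set} n" for c n
    unfolding boundary_def using supp[OF that] by (auto intro!: sum.neutral)
  have cyc: "cycles {{}::'v set} n = oriented_chains {{}} n" for n
    using bd cycles_iff by blast
  have bds: "boundaries {{}::'v set} n = {\<lambda>_. 0}"
    unfolding boundaries_eq using bd oriented_chains_zero[of "{{}}" "n + 1"] by auto
  show ?thesis
  proof (cases "n = -1")
    case False
    then have "oriented_chains {{}::'v set} n = {\<lambda>_. 0}"
    proof (intro equalityI subsetI)
      fix c :: "'v list \<Rightarrow> int" assume "c \<in> oriented_chains {{}} n"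
      then have "c xs = 0" for xs using supp[of c n xs] False by blast
      then show "c \<in> {\<lambda>_. 0}" by auto
    qed (simp add: oriented_chains_zero)
    then show ?thesis using False by (auto intro!: free_homology_acyclic simp: cyc bds)
  next
    case True
    define ev :: "('v list \<Rightarrow> int) \<Rightarrow> nat \<Rightarrow> int" where "ev c i = (if i = 0 then c [] else 0)" for c i
    have "ev ` cycles {{}} n = {f. \<forall>i\<ge>1. f i = 0}"
    proof (intro equalityI subsetI)
      fix f :: "nat \<Rightarrow> int" assume f: "f \<in> {f. \<forall>i\<ge>1. f i = 0}"
      define c :: "'v list \<Rightarrow> int" where "c xs = (if xs = [] then f 0 else 0)" for xs
      have "c \<in> oriented_chains {{}} n"
        by (rule oriented_chainsI) (auto simp: c_def alternating_def True split: if_splits)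
      moreover have "ev c = f" using f by (auto simp: ev_def c_def fun_eq_iff)
      ultimately show "f \<in> ev ` cycles {{}} n" unfolding cyc by blast
    qed (auto simp: ev_def)
    moreover have "{c \<in> cycles {{}} n. ev c = (\<lambda>_. 0)} = boundaries {{}} n"
    proof -
      have "c = (\<lambda>_. 0)" if "c \<in> oriented_chains {{}} n" "ev c = (\<lambda>_. 0)" for c
      proof
        fix xs show "c xs = 0"
          using supp[OF that(1), of xs] fun_cong[OF that(2), of 0] by (cases "xs = []") (auto simp: ev_def)
      qed
      moreover have "ev (\<lambda>_. 0) = (\<lambda>_. 0)" by (auto simp: ev_def)
      ultimately show ?thesis unfolding cyc bds using oriented_chains_zero by blast
    qed
    moreover have "ev (\<lambda>xs. c xs + d xs) = (\<lambda>i. ev c i + ev d i)" for c d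
      by (auto simp: ev_def)
    ultimately show ?thesis using True unfolding free_homology_def
      by (intro exI[of _ ev]) simp
  qed
qed

section \<open>The rank of free homology\<close>

definition int_vectors :: "nat \<Rightarrow> (nat \<Rightarrow> int) monoid" where
  "int_vectors r = \<lparr>carrier = {f. \<forall>i\<ge>r. f i = 0}, monoid.mult = (\<lambda>f g i. f i + g i), one = (\<lambda>_. 0)\<rparr>"

lemma comm_group_int_vectors: "comm_group (int_vectors r)"
proof (rule comm_groupI)
  fix x assume "x \<in> carrier (int_vectors r)"
  then show "\<exists>y\<in>carrier (int_vectors r). y \<otimes>\<^bsub>int_vectors r\<^esub> x = \<one>\<^bsub>int_vectors r\<^esub>"
    by (intro bexI[of _ "\<lambda>i. - x i"]) (auto simp: int_vectors_def)
qed (auto simp: int_vectors_def algebra_simps)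

lemma int_vectors_simps:
  "f \<otimes>\<^bsub>int_vectors r\<^esub> g = (\<lambda>i. f i + g i)"
  "\<one>\<^bsub>int_vectors r\<^esub> = (\<lambda>_. 0)"
  by (simp_all add: int_vectors_def)

lemma int_vectors_nat_pow:
  "x [^]\<^bsub>int_vectors r\<^esub> (k :: nat) = (\<lambda>i. int k * x i)"
proof (induction k)
  case (Suc k)
  then show ?case by (auto simp: int_vectors_def nat_pow_def algebra_simps)
qed (auto simp: int_vectors_def nat_pow_def)

lemma int_vectors_int_pow:
  assumes "x \<in> carrier (int_vectors r)"
  shows "x [^]\<^bsub>int_vectors r\<^esub> (k :: int) = (\<lambda>i. k * x i)"
proof -
  interpret comm_group "int_vectors r" by (rule comm_group_int_vectors)
  have inv: "inv\<^bsub>int_vectors r\<^esub> y = (\<lambda>i. - y i)" if "y \<in> carrier (int_vectors r)" for y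
    by (rule inv_equality) (use that in \<open>auto simp: int_vectors_def\<close>)
  show ?thesis
  proof (cases "k \<ge> 0")
    case True
    then have "x [^]\<^bsub>int_vectors r\<^esub> k = x [^]\<^bsub>int_vectors r\<^esub> nat k"
      unfolding int_pow_def2 by simp
    then show ?thesis using True by (simp add: int_vectors_nat_pow)
  next
    case False
    then have "x [^]\<^bsub>int_vectors r\<^esub> k = inv\<^bsub>int_vectors r\<^esub> (x [^]\<^bsub>int_vectors r\<^esub> nat (- k))"
      unfolding int_pow_def2 by simp
    then show ?thesis
      using False inv[OF nat_pow_closed[OF assms, of "nat (- k)"]]
      by (simp add: int_vectors_nat_pow)
  qed
qed

lemma int_vectors_finprod:
  assumes "finite T" "f \<in> T \<rightarrow> carrier (int_vectors r)"
  shows "(\<Otimes>\<^bsub>int_vectors r\<^esub>x\<in>T. f x) = (\<lambda>i. \<Sum>x\<in>T. f x i)"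
proof -
  interpret comm_group "int_vectors r" by (rule comm_group_int_vectors)
  show ?thesis using assms
    by (induction T rule: finite_induct) (simp_all add: int_vectors_simps)
qed

text \<open>Fraction-free Gaussian elimination: one vector \<open>p\<close> that does not vanish in the last coordinate
  clears that coordinate in all the others, after scaling them.\<close>
lemma integer_dependence:
  fixes a :: "'i \<Rightarrow> nat \<Rightarrow> int"
  assumes "finite S" "card S > r"
  shows "\<exists>m. (\<exists>x\<in>S. m x \<noteq> 0) \<and> (\<forall>j<r. (\<Sum>x\<in>S. m x * a x j) = 0)"
  using assms
proof (induction r arbitrary: S a)
  case 0
  then obtain x where "x \<in> S" by fastforce
  then show ?case by (intro exI[of _ "\<lambda>_. 1"]) auto
next
  case (Suc r)
  show ?case
  proof (cases "\<forall>x\<in>S. a x r = 0")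
    case True
    from Suc.prems have "card S > r" by simp
    from Suc.IH[OF Suc.prems(1) this] obtain m where
      "\<exists>x\<in>S. m x \<noteq> 0" "\<forall>j<r. (\<Sum>x\<in>S. m x * a x j) = 0" by blast
    then show ?thesis using True by (intro exI[of _ m]) (auto simp: less_Suc_eq)
  next
    case False
    then obtain p where p: "p \<in> S" "a p r \<noteq> 0" by blast
    let ?S = "S - {p}"
    define b where "b x j = a p r * a x j - a x r * a p j" for x j
    have "card ?S > r" "finite ?S" using Suc.prems p by auto
    from Suc.IH[OF this(2,1), of b] obtain m where
      m: "\<exists>x\<in>?S. m x \<noteq> 0" "\<forall>j<r. (\<Sum>x\<in>?S. m x * b x j) = 0" by blast
    \<comment> \<open>collect the coefficient of \<open>a p\<close> in the dependence between the vectors \<open>b x\<close>\<close>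
    define m' where "m' x = (if x = p then - (\<Sum>y\<in>?S. m y * a y r) else m x * a p r)" for x
    have "(\<Sum>x\<in>S. m' x * a x j) = (\<Sum>x\<in>?S. m x * b x j)" for j
    proof -
      have "(\<Sum>x\<in>S. m' x * a x j) = m' p * a p j + (\<Sum>x\<in>?S. m' x * a x j)"
        using Suc.prems(1) p(1) by (rule sum.remove)
      also have "(\<Sum>x\<in>?S. m' x * a x j) = (\<Sum>x\<in>?S. m x * a p r * a x j)"
        by (intro sum.cong) (auto simp: m'_def)
      also have "m' p * a p j = (\<Sum>x\<in>?S. - (m x * a x r * a p j))"
        by (simp add: m'_def sum_distrib_right sum_negf)
      also have "(\<Sum>x\<in>?S. - (m x * a x r * a p j)) + (\<Sum>x\<in>?S. m x * a p r * a x j)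
          = (\<Sum>x\<in>?S. m x * b x j)"
        unfolding sum.distrib[symmetric] by (intro sum.cong) (auto simp: b_def algebra_simps)
      finally show ?thesis .
    qed
    moreover have "b x r = 0" for x by (simp add: b_def)
    ultimately have "\<forall>j<Suc r. (\<Sum>x\<in>S. m' x * a x j) = 0"
      using m(2) by (auto simp: less_Suc_eq)
    moreover have "\<exists>x\<in>S. m' x \<noteq> 0" using m(1) p(2) by (auto simp: m'_def)
    ultimately show ?thesis by blast
  qed
qed

lemma abelian_rank_iso:
  assumes G: "comm_group G" and h: "h \<in> iso G (int_vectors r)"
  shows "abelian_rank G = r"
proof -
  interpret G: comm_group G by fact
  interpret H: comm_group "int_vectors r" by (rule comm_group_int_vectors)
  have hom: "h \<in> hom G (int_vectors r)" and bij: "bij_betw h (carrier G) (carrier (int_vectors r))"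
    using h by (auto simp: iso_def)
  interpret gh: group_hom G "int_vectors r" h
    by unfold_locales (rule hom)
  have hc: "h x \<in> carrier (int_vectors r)" if "x \<in> carrier G" for x using that by simp
  have comb: "(\<Otimes>\<^bsub>G\<^esub>x\<in>T. x [^]\<^bsub>G\<^esub> (m x :: int)) = \<one>\<^bsub>G\<^esub> \<longleftrightarrow> (\<forall>i. (\<Sum>x\<in>T. m x * h x i) = 0)"
    if T: "finite T" "T \<subseteq> carrier G" for T m
  proof -
    have cl: "(\<lambda>x. x [^]\<^bsub>G\<^esub> m x) \<in> T \<rightarrow> carrier G" using T by auto
    have "h (\<Otimes>\<^bsub>G\<^esub>x\<in>T. f x) = (\<Otimes>\<^bsub>int_vectors r\<^esub>x\<in>T. h (f x))"
      if "f \<in> T \<rightarrow> carrier G" for f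
      using T(1) that by (induction T rule: finite_induct) (auto simp: Pi_iff)
    from this[OF cl]
    have "h (\<Otimes>\<^bsub>G\<^esub>x\<in>T. x [^]\<^bsub>G\<^esub> m x) = (\<Otimes>\<^bsub>int_vectors r\<^esub>x\<in>T. h (x [^]\<^bsub>G\<^esub> m x))" .
    also have "\<dots> = (\<lambda>i. \<Sum>x\<in>T. h (x [^]\<^bsub>G\<^esub> m x) i)"
      by (rule int_vectors_finprod[OF T(1)]) (use T in auto)
    also have "\<dots> = (\<lambda>i. \<Sum>x\<in>T. m x * h x i)"
      using T(2) hc by (intro ext sum.cong refl) (auto simp: gh.hom_int_pow int_vectors_int_pow)
    finally have *: "h (\<Otimes>\<^bsub>G\<^esub>x\<in>T. x [^]\<^bsub>G\<^esub> m x) = (\<lambda>i. \<Sum>x\<in>T. m x * h x i)" .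
    have "(\<Otimes>\<^bsub>G\<^esub>x\<in>T. x [^]\<^bsub>G\<^esub> m x) = \<one>\<^bsub>G\<^esub> \<longleftrightarrow> h (\<Otimes>\<^bsub>G\<^esub>x\<in>T. x [^]\<^bsub>G\<^esub> m x) = h \<one>\<^bsub>G\<^esub>"
      by (rule inj_on_eq_iff[OF bij_betw_imp_inj_on[OF bij] G.finprod_closed[OF cl] G.one_closed, symmetric])
    also have "h \<one>\<^bsub>G\<^esub> = (\<lambda>_. 0)" using gh.hom_one by (simp add: int_vectors_def)
    finally show ?thesis unfolding * by (simp add: fun_eq_iff)
  qed
  let ?N = "{card S |S. finite S \<and> int_independent G S}"
  have le: "n \<le> r" if n: "n \<in> ?N" for n
  proof (rule ccontr)
    assume "\<not> n \<le> r"
    then obtain S where S: "finite S" "int_independent G S" "card S > r" using n by auto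
    from integer_dependence[OF S(1,3), of h] obtain m where
      m: "\<exists>x\<in>S. m x \<noteq> 0" "\<forall>j<r. (\<Sum>x\<in>S. m x * h x j) = 0" by blast
    have sub: "S \<subseteq> carrier G" using S(2) unfolding int_independent_def by blast
    have "h x i = 0" if "x \<in> S" "i \<ge> r" for x i
      using hc[of x] that sub by (auto simp: int_vectors_def)
    then have "(\<Sum>x\<in>S. m x * h x i) = 0" for i
      using m(2) by (cases "i < r") auto
    then have "\<forall>x\<in>S. m x = 0"
      using S(1,2) comb[OF S(1) sub, of m] unfolding int_independent_def by blast
    then show False using m(1) by blast
  qed
  have "r \<in> ?N"
  proof -
    define e :: "nat \<Rightarrow> nat \<Rightarrow> int" where "e j i = (if i = j then 1 else 0)" for j i
    define g where "g = inv_into (carrier G) h"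
    have e: "e j \<in> carrier (int_vectors r)" if "j < r" for j
      using that by (auto simp: e_def int_vectors_def)
    have g: "g (e j) \<in> carrier G" "h (g (e j)) = e j" if "j < r" for j
      using bij e[OF that] unfolding g_def bij_betw_def
      by (metis inv_into_into, metis f_inv_into_f)
    let ?S = "(\<lambda>j. g (e j)) ` {..<r}"
    have inj: "inj_on (\<lambda>j. g (e j)) {..<r}"
    proof (rule inj_onI)
      fix i j assume "i \<in> {..<r}" "j \<in> {..<r}" "g (e i) = g (e j)"
      then have "e i = e j" using g(2) by (metis lessThan_iff)
      then have "e i i = e j i" by simp
      then show "i = j" by (simp add: e_def split: if_splits)
    qed
    have "int_independent G ?S"
      unfolding int_independent_def
    proof (intro conjI allI impI ballI)
      show "?S \<subseteq> carrier G" using g(1) by auto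
      fix T and m :: "_ \<Rightarrow> int" and x
      assume *: "finite T \<and> T \<subseteq> ?S \<and> (\<Otimes>\<^bsub>G\<^esub>x\<in>T. x [^]\<^bsub>G\<^esub> m x) = \<one>\<^bsub>G\<^esub>" and "x \<in> T"
      then obtain j where j: "j < r" "x = g (e j)" by auto
      have "T \<subseteq> carrier G" using * g(1) by auto
      then have "(\<Sum>y\<in>T. m y * h y j) = 0" using comb * by blast
      also have "(\<Sum>y\<in>T. m y * h y j) = (\<Sum>y\<in>T. if y = x then m x else 0)"
      proof (intro sum.cong refl)
        fix y assume "y \<in> T"
        then have "y \<in> ?S" using * by blast
        then obtain i where i: "i < r" "y = g (e i)" by blast
        have "y = x \<longleftrightarrow> i = j"
          using inj_onD[OF inj, of i j] i j by auto
        moreover have "h y j = (if i = j then 1 else 0)"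
          unfolding i(2) g(2)[OF i(1)] by (auto simp: e_def)
        ultimately show "m y * h y j = (if y = x then m x else 0)" by auto
      qed
      also have "\<dots> = m x" using * \<open>x \<in> T\<close> by simp
      finally show "m x = 0" .
    qed
    moreover have "r = card ?S" using card_image[OF inj] by simp
    moreover have "finite ?S" by simp
    ultimately show ?thesis unfolding mem_Collect_eq by (intro exI[of _ ?S] conjI)
  qed
  then show ?thesis unfolding abelian_rank_def using le by (intro cSup_eq_maximum) auto
qed

text \<open>The first isomorphism theorem turns the map on cycles into an isomorphism of the homology group
  with \<open>\<int>\<^sup>r\<close>.\<close>
lemma betti_free_homology:
  fixes K :: "'v set set"
  assumes fin: "finite (\<Union>K)" and "free_homology K n r"
  shows "betti K n = r"
proof -
  obtain f :: "('v list \<Rightarrow> int) \<Rightarrow> nat \<Rightarrow> int" where f': "(\<forall>c\<in>cycles K n. \<forall>d\<in>cycles K n. f (\<lambda>xs. c xs + d xs) = (\<lambda>i. f c i + f d i)) \<and>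
      f ` cycles K n = {f. \<forall>i\<ge>r. f i = 0} \<and>
      {c \<in> cycles K n. f c = (\<lambda>_. 0)} = boundaries K n"
    using assms(2) unfolding free_homology_def by (elim exE)
  then have f: "\<And>c d. c \<in> cycles K n \<Longrightarrow> d \<in> cycles K n \<Longrightarrow> f (\<lambda>xs. c xs + d xs) = (\<lambda>i. f c i + f d i)"
    "f ` cycles K n = {f. \<forall>i\<ge>r. f i = 0}" "{c \<in> cycles K n. f c = (\<lambda>_. 0)} = boundaries K n"
    by simp_all
  let ?Z = "(chain_group K n)\<lparr>carrier := cycles K n\<rparr>"
  interpret Z: comm_group ?Z
  proof (rule comm_groupI)
    fix c assume c: "c \<in> carrier ?Z"
    show "\<exists>d\<in>carrier ?Z. d \<otimes>\<^bsub>?Z\<^esub> c = \<one>\<^bsub>?Z\<^esub>"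
      using c oriented_chains_uminus[OF fin, of c n]
      by (intro bexI[of _ "\<lambda>xs. - c xs"]) (auto simp: cycles_iff chain_group_def boundary_uminus)
  next
    show "c \<otimes>\<^bsub>?Z\<^esub> d \<in> carrier ?Z" if "c \<in> carrier ?Z" "d \<in> carrier ?Z" for c d
      using that oriented_chains_add[OF fin, of c n d] boundary_add[OF fin, of c n d]
      by (auto simp: cycles_iff chain_group_def)
    show "\<one>\<^bsub>?Z\<^esub> \<in> carrier ?Z"
      by (simp add: cycles_iff chain_group_def oriented_chains_zero boundary_def)
  qed (auto simp: chain_group_def algebra_simps)
  interpret V: comm_group "int_vectors r" by (rule comm_group_int_vectors)
  have hom: "f \<in> hom ?Z (int_vectors r)"
    using f(1,2) by (auto simp: hom_def int_vectors_def chain_group_def)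
  interpret gh: group_hom ?Z "int_vectors r" f by unfold_locales (rule hom)
  have ker: "kernel ?Z (int_vectors r) f = boundaries K n"
    using f(3) by (simp add: kernel_def int_vectors_def)
  have "(\<lambda>Y. the_elem (f ` Y)) \<in> iso (reduced_homology K n) (int_vectors r)"
    using gh.FactGroup_iso_set f(2) unfolding ker reduced_homology_def by (simp add: int_vectors_def)
  moreover have "comm_group (reduced_homology K n)"
    unfolding reduced_homology_def ker[symmetric]
    by (rule Z.abelian_FactGroup[OF gh.subgroup_kernel])
  ultimately show ?thesis unfolding betti_def by (rule abelian_rank_iso[rotated])
qed

section \<open>Weighted partitions and associated Stirling numbers\<close>

text \<open>The associated Stirling numbers of the second kind: partitions of \<open>n\<close> points into \<open>m\<close> blocks of
  size at least two. In the recursion, \<open>s\<close> is the number of companions of a fixed point.\<close>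
fun assoc_stirling :: "nat \<Rightarrow> nat \<Rightarrow> nat" where
  "assoc_stirling n 0 = (if n = 0 then 1 else 0)"
| "assoc_stirling 0 (Suc m) = 0"
| "assoc_stirling (Suc n) (Suc m) = (\<Sum>s = 1..n. (n choose s) * assoc_stirling (n - s) m)"

lemma assoc_stirling_eq_0: "n < 2 * m \<Longrightarrow> assoc_stirling n m = 0"
proof (induction n m rule: assoc_stirling.induct)
  case (3 n m)
  have "assoc_stirling (n - s) m = 0" if "s \<in> {1..n}" for s
    using that by (intro "3.IH") (use "3.prems" in auto)
  then show ?case by simp
qed auto

lemma assoc_stirling_1: "n \<ge> 2 \<Longrightarrow> assoc_stirling n 1 = 1"
proof -
  assume "n \<ge> 2"
  then obtain k where n: "n = Suc k" "k \<ge> 1" by (cases n) auto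
  have "assoc_stirling n 1 = (\<Sum>s = 1..k. (k choose s) * (if k - s = 0 then 1 else 0))"
    unfolding n by simp
  also have "\<dots> = (\<Sum>s \<in> {k}. (k choose s) * (if k - s = 0 then 1 else 0))"
    using n by (intro sum.mono_neutral_right) auto
  also have "\<dots> = 1" by simp
  finally show ?thesis .
qed

text \<open>Both sides obey the same recurrence; the two summation ranges differ by terms in which there are
  too few points for blocks of size two.\<close>
lemma coeffA_eq_assoc_stirling: "1 \<le> t \<Longrightarrow> t \<le> i \<Longrightarrow> coeffA i t = assoc_stirling (i + t) t"
proof (induction i t rule: coeffA.induct)
  case (2 i)
  then show ?case using assoc_stirling_1[of "i + 1"] by simp
next
  case (3 i r)
  have "assoc_stirling (i + Suc (Suc r)) (Suc (Suc r)) =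
      (\<Sum>s = 1..i + Suc r. ((i + Suc r) choose s) * assoc_stirling (i + Suc r - s) (Suc r))"
    by (simp del: binomial_Suc_Suc)
  also have "\<dots> = (\<Sum>s = 1..i - Suc r. ((i + Suc r) choose s) * assoc_stirling (i + Suc r - s) (Suc r))"
    by (rule sum.mono_neutral_right) (auto intro!: assoc_stirling_eq_0)
  also have "\<dots> = (\<Sum>s = 1..i - Suc r. coeffA (i - s) (Suc r) * ((i + Suc r) choose s))"
  proof (rule sum.cong[OF refl])
    fix s assume s: "s \<in> {1..i - Suc r}"
    then have "coeffA (i - s) (Suc r) = assoc_stirling (i - s + Suc r) (Suc r)"
      by (intro "3.IH") auto
    moreover have "i - s + Suc r = i + Suc r - s" using s by auto
    ultimately show "((i + Suc r) choose s) * assoc_stirling (i + Suc r - s) (Suc r) =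
        coeffA (i - s) (Suc r) * ((i + Suc r) choose s)" by (simp only: mult.commute)
  qed
  finally show ?case by simp
qed simp

text \<open>A block \<open>B\<close> of a partition of \<open>S\<close> carries the product of the \<open>u i\<close> over \<open>B\<close>, diminished by one if \<open>B\<close>
  is a singleton. This is the total weight of the partitions of \<open>S\<close> into \<open>m\<close> blocks, arranged by the
  set \<open>I\<close> of points in singleton blocks: the rest is partitioned into blocks of size at least two, and
  the weight depends only on \<open>I\<close>.\<close>
definition weighted_partitions :: "(nat \<Rightarrow> nat) \<Rightarrow> nat set \<Rightarrow> nat \<Rightarrow> nat" where
  "weighted_partitions u S m = (\<Sum>I | I \<subseteq> S \<and> card I \<le> m.
     (\<Prod>i\<in>I. u i - 1) * (\<Prod>i\<in>S - I. u i) * assoc_stirling (card (S - I)) (m - card I))"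

lemma weighted_partitions_empty: "weighted_partitions u {} m = (if m = 0 then 1 else 0)"
proof -
  have "{I. I \<subseteq> {} \<and> card I \<le> m} = {{} :: nat set}" by auto
  then show ?thesis unfolding weighted_partitions_def by (cases m) auto
qed

lemma weighted_partitions_0:
  assumes "finite S" "S \<noteq> {}"
  shows "weighted_partitions u S 0 = 0"
proof -
  have "{I. I \<subseteq> S \<and> card I \<le> 0} = {{}}"
    using assms(1) by (auto dest: finite_subset simp: card_eq_0_iff)
  then show ?thesis unfolding weighted_partitions_def using assms by simp
qed

lemma sum_Pow_card:
  fixes f :: "nat \<Rightarrow> nat"
  assumes "finite A"
  shows "(\<Sum>C | C \<subseteq> A \<and> C \<noteq> {}. f (card C)) = (\<Sum>s = 1..card A. (card A choose s) * f s)"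
proof -
  have fin: "finite {C. C \<subseteq> A \<and> C \<noteq> {}}" using assms by (rule finite_subset[rotated, OF finite_Pow_iff[THEN iffD2]]) auto
  have "(\<Sum>C | C \<subseteq> A \<and> C \<noteq> {}. f (card C)) =
      (\<Sum>s = 1..card A. \<Sum>C | C \<in> {C. C \<subseteq> A \<and> C \<noteq> {}} \<and> card C = s. f (card C))"
  proof (rule sum.group[symmetric, OF fin])
    show "card ` {C. C \<subseteq> A \<and> C \<noteq> {}} \<subseteq> {1..card A}"
      using assms by (auto simp: card_mono Suc_le_eq card_gt_0_iff finite_subset)
  qed simp
  also have "\<dots> = (\<Sum>s = 1..card A. (card A choose s) * f s)"
  proof (rule sum.cong[OF refl])
    fix s assume "s \<in> {1..card A}"
    then have "{C. C \<in> {C. C \<subseteq> A \<and> C \<noteq> {}} \<and> card C = s} = {C. C \<subseteq> A \<and> card C = s}" by auto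
    then show "(\<Sum>C | C \<in> {C. C \<subseteq> A \<and> C \<noteq> {}} \<and> card C = s. f (card C)) = (card A choose s) * f s"
      using n_subsets[OF assms, of s] by simp
  qed
  finally show ?thesis .
qed

lemma assoc_stirling_subsets:
  assumes "finite A"
  shows "assoc_stirling (Suc (card A)) (Suc m) = (\<Sum>C | C \<subseteq> A \<and> C \<noteq> {}. assoc_stirling (card (A - C)) m)"
proof -
  have "(\<Sum>C | C \<subseteq> A \<and> C \<noteq> {}. assoc_stirling (card (A - C)) m)
      = (\<Sum>C | C \<subseteq> A \<and> C \<noteq> {}. assoc_stirling (card A - card C) m)"
    using assms by (intro sum.cong refl) (metis (lifting) card_Diff_subset finite_subset mem_Collect_eq)
  then show ?thesis using sum_Pow_card[OF assms, of "\<lambda>s. assoc_stirling (card A - s) m"] by simp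
qed

text \<open>Decompose the partitions of \<open>insert x S\<close> by the block of \<open>x\<close>, which is \<open>{x}\<close> or \<open>insert x C\<close> with
  \<open>C\<close> nonempty.\<close>
lemma weighted_partitions_insert:
  assumes fin: "finite S" and x: "x \<notin> S"
  shows "weighted_partitions u (insert x S) (Suc m) =
    (u x - 1) * weighted_partitions u S m +
    (\<Sum>C | C \<subseteq> S \<and> C \<noteq> {}. (\<Prod>i\<in>insert x C. u i) * weighted_partitions u (S - C) m)"
proof -
  define T where "T A I m = (\<Prod>i\<in>I. u i - 1) * (\<Prod>i\<in>A - I. u i) * assoc_stirling (card (A - I)) (m - card I)"
    for A I m
  have G: "weighted_partitions u A m = (\<Sum>I | I \<subseteq> A \<and> card I \<le> m. T A I m)" for A m
    unfolding weighted_partitions_def T_def ..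
  have finsub: "finite I" if "I \<subseteq> S" for I using that fin finite_subset by blast
  let ?J = "{I. I \<subseteq> insert x S \<and> card I \<le> Suc m}"
  let ?A = "{I. I \<subseteq> S \<and> card I \<le> m}"
  let ?B = "{I. I \<subseteq> S \<and> card I \<le> Suc m}"
  have finA: "finite ?A" "finite ?B" using fin by auto
  have split: "?J = insert x ` ?A \<union> ?B"
  proof (intro equalityI subsetI)
    fix I assume I: "I \<in> ?J"
    show "I \<in> insert x ` ?A \<union> ?B"
    proof (cases "x \<in> I")
      case True
      then have "I = insert x (I - {x})" "I - {x} \<subseteq> S" using I by auto
      moreover have "card (I - {x}) \<le> m"
        using I True finite_subset[of I "insert x S"] fin by (auto simp: card_Diff_singleton)
      ultimately show ?thesis by blast
    qed (use I in auto)
  next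
    fix I assume "I \<in> insert x ` ?A \<union> ?B"
    then show "I \<in> ?J" using x by (auto simp: card_insert_if finsub)
  qed
  have "weighted_partitions u (insert x S) (Suc m) =
      (\<Sum>I\<in>insert x ` ?A. T (insert x S) I (Suc m)) + (\<Sum>I\<in>?B. T (insert x S) I (Suc m))"
    unfolding G split using finA x by (intro sum.union_disjoint) auto
  also have "(\<Sum>I\<in>insert x ` ?A. T (insert x S) I (Suc m)) = (\<Sum>I\<in>?A. T (insert x S) (insert x I) (Suc m))"
    by (rule sum.reindex_cong[of "insert x"]) (use x in \<open>auto simp: inj_on_def\<close>)
  also have "\<dots> = (\<Sum>I\<in>?A. (u x - 1) * T S I m)"
  proof (rule sum.cong[OF refl])
    fix I assume "I \<in> ?A"
    then have I: "I \<subseteq> S" "finite I" "x \<notin> I" "insert x S - insert x I = S - I" using x finsub by auto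
    then show "T (insert x S) (insert x I) (Suc m) = (u x - 1) * T S I m"
      unfolding T_def by simp
  qed
  also have "\<dots> = (u x - 1) * weighted_partitions u S m" unfolding G sum_distrib_left ..
  \<comment> \<open>a set \<open>I\<close> of \<open>Suc m\<close> singletons that avoids \<open>x\<close> leaves no block for \<open>x\<close>\<close>
  also have "(\<Sum>I\<in>?B. T (insert x S) I (Suc m)) = (\<Sum>I\<in>?A. T (insert x S) I (Suc m))"
  proof (rule sum.mono_neutral_right[OF finA(2)])
    show "\<forall>I\<in>?B - ?A. T (insert x S) I (Suc m) = 0"
    proof
      fix I assume I: "I \<in> ?B - ?A"
      then have c: "card I = Suc m" and "insert x S - I \<noteq> {}" using x by auto
      then have "card (insert x S - I) \<noteq> 0" using fin by simp
      then have "assoc_stirling (card (insert x S - I)) (Suc m - card I) = 0"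
        unfolding c by (metis assoc_stirling.simps(1) diff_self_eq_0)
      then show "T (insert x S) I (Suc m) = 0" unfolding T_def by (metis mult_0_right)
    qed
  qed auto
  also have "\<dots> = (\<Sum>I\<in>?A. \<Sum>C | C \<subseteq> S - I \<and> C \<noteq> {}. (\<Prod>i\<in>insert x C. u i) * T (S - C) I m)"
  proof (rule sum.cong[OF refl])
    fix I assume "I \<in> ?A"
    then have I: "I \<subseteq> S" "finite I" "x \<notin> I" "card I \<le> m" "insert x S - I = insert x (S - I)"
      using x finsub by auto
    have st: "assoc_stirling (card (insert x S - I)) (Suc m - card I) =
        (\<Sum>C | C \<subseteq> S - I \<and> C \<noteq> {}. assoc_stirling (card (S - I - C)) (m - card I))"
      using assoc_stirling_subsets[of "S - I" "m - card I"] fin x I by (simp add: Suc_diff_le)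
    show "T (insert x S) I (Suc m) = (\<Sum>C | C \<subseteq> S - I \<and> C \<noteq> {}. (\<Prod>i\<in>insert x C. u i) * T (S - C) I m)"
      unfolding T_def st sum_distrib_left
    proof (rule sum.cong[OF refl])
      fix C assume "C \<in> {C. C \<subseteq> S - I \<and> C \<noteq> {}}"
      then have C: "C \<subseteq> S - I" "finite C" "x \<notin> C" using x finsub by auto
      have comm: "S - I - C = S - C - I" by blast
      have "(\<Prod>i\<in>insert x S - I. u i) = u x * (\<Prod>i\<in>S - I. u i)"
        unfolding I(5) using fin x by simp
      also have "(\<Prod>i\<in>S - I. u i) = (\<Prod>i\<in>S - I - C. u i) * (\<Prod>i\<in>C. u i)"
        by (rule prod.subset_diff[OF C(1)]) (use fin in simp)
      finally have "(\<Prod>i\<in>insert x S - I. u i) = (\<Prod>i\<in>insert x C. u i) * (\<Prod>i\<in>S - C - I. u i)"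
        using C by (simp add: comm ac_simps)
      then show "(\<Prod>i\<in>I. u i - 1) * (\<Prod>i\<in>insert x S - I. u i) * assoc_stirling (card (S - I - C)) (m - card I)
        = (\<Prod>i\<in>insert x C. u i) *
          ((\<Prod>i\<in>I. u i - 1) * (\<Prod>i\<in>S - C - I. u i) * assoc_stirling (card (S - C - I)) (m - card I))"
        by (simp add: comm ac_simps)
    qed
  qed
  also have "\<dots> = (\<Sum>I\<in>?A. \<Sum>C | C \<in> {C. C \<subseteq> S \<and> C \<noteq> {}} \<and> I \<inter> C = {}.
      (\<Prod>i\<in>insert x C. u i) * T (S - C) I m)"
    by (intro sum.cong refl) auto
  also have "\<dots> = (\<Sum>C | C \<subseteq> S \<and> C \<noteq> {}. \<Sum>I | I \<in> ?A \<and> I \<inter> C = {}.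
      (\<Prod>i\<in>insert x C. u i) * T (S - C) I m)"
    by (rule sum.swap_restrict[OF finA(1)]) (use fin in auto)
  also have "\<dots> = (\<Sum>C | C \<subseteq> S \<and> C \<noteq> {}. (\<Prod>i\<in>insert x C. u i) * weighted_partitions u (S - C) m)"
    unfolding G sum_distrib_left by (intro sum.cong refl) auto
  finally show ?thesis .
qed

text \<open>Grouping the sets of singletons by their size produces the elementary expressions \<open>sigma\<close>; here
  \<open>t\<close> is the number of blocks of size at least two.\<close>
lemma weighted_partitions_eq_sum_sigma:
  assumes pos: "\<And>i. i < length us \<Longrightarrow> us ! i \<ge> 1" and m: "m \<le> length us"
  shows "int (weighted_partitions (\<lambda>i. us ! i) {..<length us} m) =
    (\<Sum>t = 0..m. int (assoc_stirling (length us - m + t) t) * sigma (int m - int t) us)"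
proof -
  let ?K = "{..<length us}"
  let ?A = "{I. I \<subseteq> ?K \<and> card I \<le> m}"
  define f where "f I = (\<Prod>i\<in>I. int (us ! i) - 1) * (\<Prod>i\<in>?K - I. int (us ! i))" for I
  have "int (weighted_partitions (\<lambda>i. us ! i) ?K m) =
      (\<Sum>I\<in>?A. f I * int (assoc_stirling (card (?K - I)) (m - card I)))"
    unfolding weighted_partitions_def of_nat_sum of_nat_mult of_nat_prod f_def
  proof (rule sum.cong[OF refl])
    fix I assume "I \<in> ?A"
    then have "(\<Prod>i\<in>I. int (us ! i - 1)) = (\<Prod>i\<in>I. int (us ! i) - 1)"
      by (intro prod.cong refl) (use pos in \<open>auto simp: of_nat_diff\<close>)
    then show "(\<Prod>i\<in>I. int (us ! i - 1)) * (\<Prod>i\<in>?K - I. int (us ! i)) *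
        int (assoc_stirling (card (?K - I)) (m - card I)) =
      (\<Prod>i\<in>I. int (us ! i) - 1) * (\<Prod>i\<in>?K - I. int (us ! i)) *
        int (assoc_stirling (card (?K - I)) (m - card I))" by simp
  qed
  also have "\<dots> = (\<Sum>t = 0..m. \<Sum>I | I \<in> ?A \<and> m - card I = t.
      f I * int (assoc_stirling (card (?K - I)) (m - card I)))"
    by (rule sum.group[symmetric]) auto
  also have "\<dots> = (\<Sum>t = 0..m. int (assoc_stirling (length us - m + t) t) * sigma (int m - int t) us)"
  proof (rule sum.cong[OF refl])
    fix t assume t: "t \<in> {0..m}"
    have eq: "{I. I \<in> ?A \<and> m - card I = t} = {I. I \<subseteq> ?K \<and> int (card I) = int m - int t}"
      using t by auto
    show "(\<Sum>I | I \<in> ?A \<and> m - card I = t. f I * int (assoc_stirling (card (?K - I)) (m - card I))) =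
        int (assoc_stirling (length us - m + t) t) * sigma (int m - int t) us"
      unfolding eq sigma_def f_def[symmetric] sum_distrib_left
    proof (rule sum.cong[OF refl])
      fix I assume I: "I \<in> {I. I \<subseteq> ?K \<and> int (card I) = int m - int t}"
      then have "card (?K - I) = length us - card I"
        using card_Diff_subset[of I ?K] finite_subset[of I ?K] by simp
      also have "\<dots> = length us - m + t" using I m t by auto
      finally have "card (?K - I) = length us - m + t" .
      moreover have "m - card I = t" using I by auto
      ultimately show "f I * int (assoc_stirling (card (?K - I)) (m - card I)) =
          int (assoc_stirling (length us - m + t) t) * f I" by (simp only: mult.commute)
    qed
  qed
  finally show ?thesis .
qed

lemma sigma_negative: "n < 0 \<Longrightarrow> sigma n us = 0"
proof -
  assume "n < 0"
  then have "{I. I \<subseteq> {..<length us} \<and> int (card I) = n} = {}" by auto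
  then show ?thesis unfolding sigma_def by (simp only: sum.empty)
qed

lemma weighted_partitions_top:
  assumes "\<And>i. i < length us \<Longrightarrow> us ! i \<ge> 1"
  shows "int (weighted_partitions (\<lambda>i. us ! i) {..<length us} (length us)) = sigma (int (length us)) us"
proof -
  let ?g = "\<lambda>t. int (assoc_stirling (length us - length us + t) t) * sigma (int (length us) - int t) us"
  have "(\<Sum>t = 0..length us. ?g t) = (\<Sum>t\<in>{0}. ?g t)"
    by (rule sum.mono_neutral_right) (auto simp: assoc_stirling_eq_0)
  then show ?thesis using weighted_partitions_eq_sum_sigma[OF assms order_refl] by simp
qed

text \<open>The summation range \<open>{1..j - 1}\<close> comes from the vanishing of the other terms: for \<open>t = 0\<close> the \<open>j - 1\<close>
  remaining points would have no block, for \<open>t > j - 1\<close> there are fewer than \<open>2 * t\<close> of them, and \<open>sigma\<close>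
  vanishes at negative indices.\<close>
lemma weighted_partitions_coeffA:
  assumes pos: "\<And>i. i < length us \<Longrightarrow> us ! i \<ge> 1" and j: "2 \<le> j" "j \<le> length us"
  shows "int (weighted_partitions (\<lambda>i. us ! i) {..<length us} (length us - j + 1)) =
    (\<Sum>t = 1..j - 1. int (coeffA (j - 1) t) * sigma (int (length us) - int j - int t + 1) us)"
proof -
  let ?m = "length us - j + 1"
  let ?g = "\<lambda>t. int (assoc_stirling (j - 1 + t) t) * sigma (int ?m - int t) us"
  have "?m \<le> length us" "length us - ?m = j - 1" using j by auto
  then have "int (weighted_partitions (\<lambda>i. us ! i) {..<length us} ?m) = (\<Sum>t = 0..?m. ?g t)"
    using weighted_partitions_eq_sum_sigma[OF pos, of ?m] by simp
  also have "\<dots> = (\<Sum>t \<in> {0..?m} \<union> {1..j - 1}. ?g t)"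
    by (rule sum.mono_neutral_left) (auto simp: sigma_negative)
  also have "\<dots> = (\<Sum>t = 1..j - 1. ?g t)"
  proof (rule sum.mono_neutral_right)
    show "\<forall>t\<in>{0..?m} \<union> {1..j - 1} - {1..j - 1}. ?g t = 0"
    proof
      fix t assume "t \<in> {0..?m} \<union> {1..j - 1} - {1..j - 1}"
      then have "t = 0 \<or> j - 1 + t < 2 * t" by auto
      then have "assoc_stirling (j - 1 + t) t = 0" using j(1) by (auto simp: assoc_stirling_eq_0)
      then show "?g t = 0" by simp
    qed
  qed auto
  also have "\<dots> = (\<Sum>t = 1..j - 1. int (coeffA (j - 1) t) * sigma (int (length us) - int j - int t + 1) us)"
  proof (rule sum.cong[OF refl])
    fix t assume "t \<in> {1..j - 1}"
    then have "coeffA (j - 1) t = assoc_stirling (j - 1 + t) t"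
      by (intro coeffA_eq_assoc_stirling) auto
    moreover have "int ?m - int t = int (length us) - int j - int t + 1" using j by simp
    ultimately show "?g t = int (coeffA (j - 1) t) * sigma (int (length us) - int j - int t + 1) us"
      by (simp only:)
  qed
  finally show ?thesis .
qed

section \<open>Clique complexes\<close>

lemma finite_Union_clique_complex: "finite V \<Longrightarrow> finite (\<Union>(clique_complex V adj))"
  by (rule finite_subset[of _ V]) (auto simp: clique_complex_def)

lemma clique_complex_down: "F \<in> clique_complex V adj \<Longrightarrow> G \<subseteq> F \<Longrightarrow> G \<in> clique_complex V adj"
  unfolding clique_complex_def by (auto intro: finite_subset)

lemma free_homology_apex:
  assumes "finite V" "e \<in> V" "\<And>y. y \<in> V \<Longrightarrow> y \<noteq> e \<Longrightarrow> adj e y \<and> adj y e"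
  shows "free_homology (clique_complex V adj) n 0"
proof (rule free_homology_cone[where x = e])
  show "finite (\<Union>(clique_complex V adj))" by (rule finite_Union_clique_complex[OF assms(1)])
  show "G \<in> clique_complex V adj" if "F \<in> clique_complex V adj" "G \<subseteq> F" for F G
    by (rule clique_complex_down[OF that])
  show "clique_complex V adj \<noteq> {}" unfolding clique_complex_def by blast
  show "insert e F \<in> clique_complex V adj" if "F \<in> clique_complex V adj" for F
    using that assms(2,3) unfolding clique_complex_def by blast
qed

lemma free_homology_dominated:
  assumes "finite V" and v: "v \<in> V" and w: "w \<in> V" "w \<noteq> v"
    and sym: "\<And>a b. a \<in> V \<Longrightarrow> b \<in> V \<Longrightarrow> adj a b \<Longrightarrow> adj b a"
    and irrefl: "\<And>a. a \<in> V \<Longrightarrow> \<not> adj a a"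
    and dom: "\<And>y. y \<in> V \<Longrightarrow> adj v y \<Longrightarrow> adj w y"
    and X: "free_homology (clique_complex (V - {v}) adj) n r"
    and L: "free_homology (clique_complex {y \<in> V. adj v y} adj) (n - 1) s"
  shows "free_homology (clique_complex V adj) n (r + s)"
proof -
  interpret dominated_vertex "clique_complex V adj" "clique_complex (V - {v}) adj"
    "clique_complex {y \<in> V. adj v y} adj" v w
  proof
    show "finite (\<Union>(clique_complex V adj))" by (rule finite_Union_clique_complex[OF assms(1)])
    show "G \<in> clique_complex V adj" if "F \<in> clique_complex V adj" "G \<subseteq> F" for F G
      by (rule clique_complex_down[OF that])
    show "{v} \<in> clique_complex V adj" using v unfolding clique_complex_def by simp
    show "clique_complex (V - {v}) adj = {F \<in> clique_complex V adj. v \<notin> F}"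
      unfolding clique_complex_def by blast
    show "clique_complex {y \<in> V. adj v y} adj = {F. v \<notin> F \<and> insert v F \<in> clique_complex V adj}"
    proof (intro equalityI subsetI)
      fix F assume F: "F \<in> clique_complex {y \<in> V. adj v y} adj"
      then have "F \<subseteq> V" "\<forall>y\<in>F. adj v y \<and> adj y v"
        using sym v unfolding clique_complex_def by blast+
      then show "F \<in> {F. v \<notin> F \<and> insert v F \<in> clique_complex V adj}"
        using F irrefl v unfolding clique_complex_def by auto
    next
      fix F assume "F \<in> {F. v \<notin> F \<and> insert v F \<in> clique_complex V adj}"
      then show "F \<in> clique_complex {y \<in> V. adj v y} adj"
        unfolding clique_complex_def by fastforce
    qed
    show "insert w F \<in> clique_complex (V - {v}) adj"
      if F: "F \<in> clique_complex {y \<in> V. adj v y} adj" for F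
    proof -
      have "\<forall>y\<in>F. y \<in> V \<and> adj v y" using F unfolding clique_complex_def by blast
      then have "\<forall>y\<in>F. y \<in> V - {v} \<and> adj w y \<and> adj y w" using dom sym w(1) irrefl by blast
      moreover have "finite F" "\<forall>a\<in>F. \<forall>b\<in>F. a \<noteq> b \<longrightarrow> adj a b"
        using F unfolding clique_complex_def by blast+
      ultimately show ?thesis using w unfolding clique_complex_def by auto
    qed
  qed
  show ?thesis by (rule free_homology_add[OF X L])
qed

text \<open>Remove the vertices in \<open>D\<close> one at a time. Each is dominated by \<open>e\<close>, and as they are
  pairwise not joined, no removal changes the link of a later one. What remains at the end is a cone
  with apex \<open>e\<close>.\<close>
lemma free_homology_star:
  assumes "finite D" "finite V" and e: "e \<in> V"
    and sym: "\<And>a b. a \<in> V \<Longrightarrow> b \<in> V \<Longrightarrow> adj a b \<Longrightarrow> adj b a"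
    and irrefl: "\<And>a. a \<in> V \<Longrightarrow> \<not> adj a a"
    and D: "D = {v \<in> V. v \<noteq> e \<and> \<not> adj e v}"
    and indep: "\<And>v v'. v \<in> D \<Longrightarrow> v' \<in> D \<Longrightarrow> \<not> adj v v'"
    and dom: "\<And>v y. v \<in> D \<Longrightarrow> y \<in> V \<Longrightarrow> adj v y \<Longrightarrow> adj e y"
    and L: "\<And>v. v \<in> D \<Longrightarrow> free_homology (clique_complex {y \<in> V. adj v y} adj) (n - 1) (r v)"
  shows "free_homology (clique_complex V adj) n (\<Sum>v\<in>D. r v)"
  using assms
proof (induction D arbitrary: V rule: finite_induct)
  case empty
  have "free_homology (clique_complex V adj) n 0"
    by (rule free_homology_apex[of V e]) (use empty in blast)+
  then show ?case by simp
next
  case (insert v D)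
  have v: "v \<in> V" "v \<noteq> e" "\<not> adj e v" using insert.prems(5) by blast+
  have nb: "{y \<in> V - {v}. adj u y} = {y \<in> V. adj u y}" if "u \<in> D" for u
    using insert.prems(6)[of u v] that by blast
  have X: "free_homology (clique_complex (V - {v}) adj) n (\<Sum>v\<in>D. r v)"
  proof (rule insert.IH)
    show "finite (V - {v})" "e \<in> V - {v}" using insert.prems(1,2) v by auto
    show "adj b a" if "a \<in> V - {v}" "b \<in> V - {v}" "adj a b" for a b
      using insert.prems(3) that by blast
    show "\<not> adj a a" if "a \<in> V - {v}" for a using insert.prems(4) that by blast
    show "D = {u \<in> V - {v}. u \<noteq> e \<and> \<not> adj e u}"
      using insert.prems(5) insert.hyps(2) by blast
    show "\<not> adj a b" if "a \<in> D" "b \<in> D" for a b using insert.prems(6) that by blast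
    show "adj e y" if "a \<in> D" "y \<in> V - {v}" "adj a y" for a y
      using insert.prems(7) that by blast
    show "free_homology (clique_complex {y \<in> V - {v}. adj a y} adj) (n - 1) (r a)" if "a \<in> D" for a
      unfolding nb[OF that] using insert.prems(8) that by blast
  qed
  have "free_homology (clique_complex V adj) n ((\<Sum>v\<in>D. r v) + r v)"
  proof (rule free_homology_dominated[where v = v and w = e])
    show "free_homology (clique_complex {y \<in> V. adj v y} adj) (n - 1) (r v)"
      by (rule insert.prems(8)) simp
    show "adj e y" if "y \<in> V" "adj v y" for y using insert.prems(7)[of v y] that by blast
    show "finite V" "v \<in> V" "e \<in> V" "e \<noteq> v" using insert.prems(1,2) v by blast+
    show "adj b a" if "a \<in> V" "b \<in> V" "adj a b" for a b by (rule insert.prems(3)[OF that])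
    show "\<not> adj a a" if "a \<in> V" for a by (rule insert.prems(4)[OF that])
    show "free_homology (clique_complex (V - {v}) adj) n (\<Sum>v\<in>D. r v)" by (rule X)
  qed
  then show ?case using insert.hyps by (simp add: add.commute)
qed

text \<open>The recursion for the block of a point \<open>x\<close> in a weighted partition is the recursion for the homology
  of the vertices supported in \<open>S\<close>. Let \<open>e\<close> be a vertex with support \<open>{x}\<close>. The vertices not joined to
  \<open>e\<close> are those whose support contains \<open>x\<close>; they are pairwise not joined, \<open>e\<close> dominates them, and the
  link of such a vertex \<open>v\<close> consists of the vertices supported in the complement of \<open>supp v\<close> in \<open>S\<close>. The
  exception \<open>S = K\<close>, \<open>m = 1\<close> is the only case in which the absent vertices of full support would be
  counted.\<close>
lemma free_homology_disjoint_supports: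
  fixes supp :: "'v \<Rightarrow> nat set"
  assumes finW: "finite W" and finK: "finite K" and K2: "card K \<ge> 2"
    and supp: "\<And>v. v \<in> W \<Longrightarrow> supp v \<subseteq> K \<and> supp v \<noteq> {} \<and> supp v \<noteq> K"
    and adj: "\<And>a b. a \<in> W \<Longrightarrow> b \<in> W \<Longrightarrow> adj a b \<longleftrightarrow> supp a \<inter> supp b = {}"
    and count: "\<And>B. B \<subseteq> K \<Longrightarrow> B \<noteq> {} \<Longrightarrow> B \<noteq> K \<Longrightarrow> card {v \<in> W. supp v = B} = (\<Prod>i\<in>B. u i)"
    and pos: "\<And>i. i \<in> K \<Longrightarrow> u i \<ge> 1"
  assumes "S \<subseteq> K" "S \<noteq> K \<or> m \<noteq> 1"
  shows "free_homology (clique_complex {v \<in> W. supp v \<subseteq> S} adj) (int m - 1) (weighted_partitions u S m)"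
  using assms(8,9)
proof (induction "card S" arbitrary: S m rule: less_induct)
  case less
  have finS: "finite S" using less.prems finK finite_subset by blast
  show ?case
  proof (cases "S = {}")
    case True
    have "{v \<in> W. supp v \<subseteq> S} = {}" using True supp by blast
    then have "clique_complex {v \<in> W. supp v \<subseteq> S} adj = {{}}" unfolding clique_complex_def by auto
    then show ?thesis
      using free_homology_empty_simplex[of "int m - 1"] True by (simp add: weighted_partitions_empty)
  next
    case False
    then obtain x where x: "x \<in> S" by blast
    let ?V = "{v \<in> W. supp v \<subseteq> S}"
    define R where "R = S - {x}"
    have S: "S = insert x R" "x \<notin> R" "finite R" using x finS by (auto simp: R_def)
    have xK: "x \<in> K" using x less.prems by blast
    have xne: "{x} \<noteq> K" using K2 by auto
    have card_x: "card {v \<in> W. supp v = {x}} = u x" using count[of "{x}"] xK xne by simp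
    then have "{v \<in> W. supp v = {x}} \<noteq> {}" using pos[OF xK] by (metis card.empty not_one_le_zero)
    then obtain e where e: "e \<in> W" "supp e = {x}" by blast
    define D where "D = {v \<in> ?V. v \<noteq> e \<and> \<not> adj e v}"
    have D: "D = {v \<in> W. supp v \<subseteq> S \<and> x \<in> supp v \<and> v \<noteq> e}"
      unfolding D_def using adj[OF e(1)] e(2) by auto
    have finD: "finite D" using finW unfolding D by simp
    define r where "r v = (case m of 0 \<Rightarrow> 0 | Suc m' \<Rightarrow> weighted_partitions u (S - supp v) m')" for v
    have main: "free_homology (clique_complex ?V adj) (int m - 1) (\<Sum>v\<in>D. r v)"
    proof (rule free_homology_star[where e = e and adj = adj])
      show "finite D" by (rule finD)
      show "D = {v \<in> ?V. v \<noteq> e \<and> \<not> adj e v}" by (rule D_def)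
      show "finite ?V" using finW by simp
      show "e \<in> ?V" using e x by simp
      show "adj b a" if "a \<in> ?V" "b \<in> ?V" "adj a b" for a b
        using that adj[of a b] adj[of b a] by (simp add: Int_commute)
      show "\<not> adj a a" if "a \<in> ?V" for a using that adj[of a a] supp[of a] by simp
      show "\<not> adj a b" if "a \<in> D" "b \<in> D" for a b using that adj[of a b] unfolding D by auto
      show "adj e y" if "a \<in> D" "y \<in> ?V" "adj a y" for a y
        using that adj[of a y] adj[of e y] e unfolding D by auto
      show "free_homology (clique_complex {y \<in> ?V. adj v y} adj) (int m - 1 - 1) (r v)" if v: "v \<in> D" for v
      proof (cases m)
        case 0
        then show ?thesis unfolding r_def by (simp add: free_homology_below)
      next
        case (Suc m')
        have vW: "v \<in> W" using v unfolding D by blast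
        have nb: "{y \<in> ?V. adj v y} = {y \<in> W. supp y \<subseteq> S - supp v}" using adj[OF vW] by auto
        have "S - supp v \<subset> S" using v x unfolding D by blast
        then have "card (S - supp v) < card S" by (rule psubset_card_mono[OF finS])
        moreover have "S - supp v \<subseteq> K" using less.prems(1) by blast
        moreover have "S - supp v \<noteq> K" using \<open>S - supp v \<subset> S\<close> less.prems(1) by blast
        ultimately show ?thesis using less.hyps[of "S - supp v" m'] unfolding nb r_def Suc by simp
      qed
    qed
    have "(\<Sum>v\<in>D. r v) = weighted_partitions u S m"
    proof (cases m)
      case 0
      then show ?thesis unfolding r_def using weighted_partitions_0[OF finS False] by simp
    next
      case (Suc m')
      let ?P = "\<lambda>C. weighted_partitions u (R - C) m'"
      have fib: "{v \<in> D. supp v - {x} = C} = {v \<in> W. supp v = insert x C} - {e}" if "C \<subseteq> R" for C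
        using that S unfolding D by blast
      have fib0: "card {v \<in> D. supp v - {x} = {}} = u x - 1"
        unfolding fib[OF empty_subsetI] using card_x e by (simp add: card_Diff_singleton)
      have fib1: "card {v \<in> D. supp v - {x} = C} * ?P C = (\<Prod>i\<in>insert x C. u i) * ?P C"
        if C: "C \<subseteq> R" "C \<noteq> {}" for C
      \<comment> \<open>no vertex has support \<open>K\<close>, and the term vanishes because \<open>{}\<close> has no partition into \<open>m' > 0\<close> blocks\<close>
      proof (cases "insert x C = K")
        case True
        then have "S = K" "R = C" using less.prems(1) S C xK by auto
        then have "m' \<noteq> 0" using less.prems(2) Suc by simp
        then show ?thesis using \<open>R = C\<close> by (simp add: weighted_partitions_empty)
      next
        case ne: False
        have "{v \<in> D. supp v - {x} = C} = {v \<in> W. supp v = insert x C}"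
          unfolding fib[OF C(1)] using e C S(2) by auto
        moreover have "insert x C \<subseteq> K" using C S less.prems(1) by blast
        ultimately show ?thesis using count[of "insert x C"] ne by simp
      qed
      have "(\<Sum>v\<in>D. r v) = (\<Sum>C\<in>Pow R. \<Sum>v | v \<in> D \<and> supp v - {x} = C. r v)"
        by (rule sum.group[symmetric, OF finD]) (use S in \<open>auto simp: D\<close>)
      also have "\<dots> = (\<Sum>C\<in>Pow R. card {v \<in> D. supp v - {x} = C} * ?P C)"
      proof (rule sum.cong[OF refl])
        fix C assume "C \<in> Pow R"
        have "r v = ?P C" if "v \<in> {v \<in> D. supp v - {x} = C}" for v
        proof -
          have "S - supp v = R - C" using that S(1,2) unfolding D by auto
          then show ?thesis unfolding r_def Suc by simp
        qed
        then show "(\<Sum>v | v \<in> D \<and> supp v - {x} = C. r v) = card {v \<in> D. supp v - {x} = C} * ?P C"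
          by simp
      qed
      also have "Pow R = insert {} {C. C \<subseteq> R \<and> C \<noteq> {}}" by blast
      also have "(\<Sum>C\<in>insert {} {C. C \<subseteq> R \<and> C \<noteq> {}}. card {v \<in> D. supp v - {x} = C} * ?P C) =
          (u x - 1) * ?P {} + (\<Sum>C | C \<subseteq> R \<and> C \<noteq> {}. card {v \<in> D. supp v - {x} = C} * ?P C)"
        using S(3) fib0 by (subst sum.insert) auto
      also have "\<dots> = (u x - 1) * ?P {} + (\<Sum>C | C \<subseteq> R \<and> C \<noteq> {}. (\<Prod>i\<in>insert x C. u i) * ?P C)"
        using fib1 by (intro arg_cong2[where f = "(+)"] sum.cong refl) blast
      also have "\<dots> = weighted_partitions u S m"
        unfolding S(1) Suc weighted_partitions_insert[OF S(3,2)] by simp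
      finally show ?thesis .
    qed
    then show ?thesis using main by simp
  qed
qed

section \<open>Products of finite fields\<close>

lemma RDirProd_list_mult_nth:
  assumes "as \<in> carrier (RDirProd_list Rs)" "bs \<in> carrier (RDirProd_list Rs)" "i < length Rs"
  shows "(as \<otimes>\<^bsub>RDirProd_list Rs\<^esub> bs) ! i = as ! i \<otimes>\<^bsub>Rs ! i\<^esub> bs ! i"
  using assms
proof (induction Rs arbitrary: as bs i)
  case (Cons R Rs)
  obtain a as' where as: "as = a # as'" "a \<in> carrier R" "as' \<in> carrier (RDirProd_list Rs)"
    using Cons.prems(1) unfolding RDirProd_list_carrier by auto
  obtain b bs' where bs: "bs = b # bs'" "b \<in> carrier R" "bs' \<in> carrier (RDirProd_list Rs)"
    using Cons.prems(2) unfolding RDirProd_list_carrier by auto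
  have "(a, as') \<in> carrier (RDirProd R (RDirProd_list Rs))" "(b, bs') \<in> carrier (RDirProd R (RDirProd_list Rs))"
    using as bs by (auto simp: RDirProd_carrier)
  from ring_hom_mult[OF RDirProd_list_hom1 this]
  have "as \<otimes>\<^bsub>RDirProd_list (R # Rs)\<^esub> bs = (a \<otimes>\<^bsub>R\<^esub> b) # (as' \<otimes>\<^bsub>RDirProd_list Rs\<^esub> bs')"
    using as bs by (simp add: RDirProd_def DirProd_def monoid.defs)
  then show ?case using Cons.IH[OF as(3) bs(3)] Cons.prems(3) as(1) bs(1) by (cases i) auto
qed simp

lemma RDirProd_list_zero_nth:
  "i < length Rs \<Longrightarrow> \<zero>\<^bsub>RDirProd_list Rs\<^esub> ! i = \<zero>\<^bsub>Rs ! i\<^esub>"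
  "length \<zero>\<^bsub>RDirProd_list Rs\<^esub> = length Rs"
proof -
  show "length \<zero>\<^bsub>RDirProd_list Rs\<^esub> = length Rs"
    unfolding RDirProd_list_zero by (induction Rs) simp_all
  show "i < length Rs \<Longrightarrow> \<zero>\<^bsub>RDirProd_list Rs\<^esub> ! i = \<zero>\<^bsub>Rs ! i\<^esub>"
    by (induction Rs arbitrary: i) (auto simp: RDirProd_list_zero' nth_Cons split: nat.splits)
qed

lemma card_Units_finite_field:
  assumes "field R" "finite (carrier R)"
  shows "card (Units R) \<ge> 1"
proof -
  interpret field R by fact
  have "finite (Units R)"
    using assms(2) by (rule finite_subset[rotated]) (auto simp: Units_def)
  moreover have "\<one>\<^bsub>R\<^esub> \<in> Units R" by simp
  ultimately show ?thesis by (metis One_nat_def Suc_leI card_gt_0_iff empty_iff)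
qed

lemma card_RDirProd_list_support:
  assumes field: "\<And>i. i < length Rs \<Longrightarrow> field (Rs ! i)" and B: "B \<subseteq> {..<length Rs}"
  shows "card {as \<in> carrier (RDirProd_list Rs). {i. i < length Rs \<and> as ! i \<noteq> \<zero>\<^bsub>Rs ! i\<^esub>} = B}
    = (\<Prod>i\<in>B. card (Units (Rs ! i)))" (is "card ?L = _")
proof -
  let ?k = "length Rs"
  define E where "E i = (if i \<in> B then Units (Rs ! i) else {\<zero>\<^bsub>Rs ! i\<^esub>})" for i
  have U: "Units (Rs ! i) = carrier (Rs ! i) - {\<zero>\<^bsub>Rs ! i\<^esub>}" if "i < ?k" for i
    using field.field_Units[OF field[OF that]] .
  have z: "\<zero>\<^bsub>Rs ! i\<^esub> \<in> carrier (Rs ! i)" if "i < ?k" for i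
  proof -
    interpret field "Rs ! i" by (rule field[OF that])
    show ?thesis by simp
  qed
  have mem: "as \<in> ?L \<longleftrightarrow> length as = ?k \<and> (\<forall>i<?k. as ! i \<in> E i)" for as
  proof
    assume "as \<in> ?L"
    then have 1: "as \<in> carrier (RDirProd_list Rs)" and 2: "{i. i < ?k \<and> as ! i \<noteq> \<zero>\<^bsub>Rs ! i\<^esub>} = B" by auto
    show "length as = ?k \<and> (\<forall>i<?k. as ! i \<in> E i)"
      using RDirProd_list_carrier_mem[OF 1] 2 U unfolding E_def by auto
  next
    assume 1: "length as = ?k \<and> (\<forall>i<?k. as ! i \<in> E i)"
    have "as ! i \<in> carrier (Rs ! i)" if "i < ?k" for i
      using 1 that U[OF that] z[OF that] unfolding E_def by (cases "i \<in> B") auto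
    moreover have "as ! i \<noteq> \<zero>\<^bsub>Rs ! i\<^esub> \<longleftrightarrow> i \<in> B" if "i < ?k" for i
      using 1 that U[OF that] unfolding E_def by (cases "i \<in> B") auto
    ultimately show "as \<in> ?L" using 1 B by (auto intro: RDirProd_list_carrier_memI)
  qed
  have "bij_betw (\<lambda>f. map f [0..<?k]) (PiE {..<?k} E) ?L"
  proof (rule bij_betw_byWitness[where f' = "\<lambda>as. restrict ((!) as) {..<?k}"])
    show "\<forall>f\<in>PiE {..<?k} E. restrict ((!) (map f [0..<?k])) {..<?k} = f"
    proof (intro ballI ext)
      fix f i assume "f \<in> PiE {..<?k} E"
      then show "restrict ((!) (map f [0..<?k])) {..<?k} i = f i"
        by (cases "i < ?k") (simp_all add: PiE_arb[of f "{..<?k}" E i])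
    qed
    show "\<forall>as\<in>?L. map (restrict ((!) as) {..<?k}) [0..<?k] = as"
    proof
      fix as assume "as \<in> ?L"
      then have "length as = ?k" using mem by blast
      then show "map (restrict ((!) as) {..<?k}) [0..<?k] = as" by (intro nth_equalityI) simp_all
    qed
    show "(\<lambda>f. map f [0..<?k]) ` PiE {..<?k} E \<subseteq> ?L"
    proof (intro image_subsetI)
      fix f assume f: "f \<in> PiE {..<?k} E"
      show "map f [0..<?k] \<in> ?L" unfolding mem using PiE_mem[OF f] by simp
    qed
    show "(\<lambda>as. restrict ((!) as) {..<?k}) ` ?L \<subseteq> PiE {..<?k} E"
    proof (intro image_subsetI)
      fix as assume "as \<in> ?L"
      then have "\<forall>i<?k. as ! i \<in> E i" using mem by blast
      then show "restrict ((!) as) {..<?k} \<in> PiE {..<?k} E" by (intro restrict_PiE_iff[THEN iffD2]) simp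
    qed
  qed
  then have "card ?L = card (PiE {..<?k} E)" by (rule bij_betw_same_card[symmetric])
  also have "\<dots> = (\<Prod>i<?k. card (E i))" by (simp add: card_PiE)
  also have "\<dots> = (\<Prod>i\<in>B. card (E i))"
    by (rule prod.mono_neutral_right) (use B in \<open>auto simp: E_def\<close>)
  also have "\<dots> = (\<Prod>i\<in>B. card (Units (Rs ! i)))" by (simp add: E_def)
  finally show ?thesis .
qed

text \<open>In a product of fields an element is zero iff its support is empty, and the support of a product
  is the intersection of the supports. Hence the nonzero zero-divisors are the elements whose support
  is nonempty and proper, and adjacency is disjointness of supports.\<close>
lemma free_homology_zero_divisor_complex:
  fixes \<Omega> :: "('a, 'm) ring_scheme"
    and Rs :: "('b, 'n) ring_scheme list"
  assumes cring: "cring \<Omega>" and fin: "finite (carrier \<Omega>)"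
    and fields: "\<And>R. R \<in> set Rs \<Longrightarrow> field R \<and> finite (carrier R)"
    and iso: "\<Omega> \<simeq> RDirProd_list Rs" and k: "length Rs \<ge> 2" and m: "m \<noteq> 1"
  shows "free_homology (zero_divisor_complex \<Omega>) (int m - 1)
    (weighted_partitions (\<lambda>i. card (Units (Rs ! i))) {..<length Rs} m)"
proof -
  interpret cring \<Omega> by fact
  let ?k = "length Rs" and ?P = "RDirProd_list Rs" and ?W = "nonzero_zero_divisors \<Omega>"
  have field: "field (Rs ! i)" if "i < ?k" for i using fields that by simp
  have "ring ?P" by (rule RDirProd_list_is_ring) (use field in \<open>auto simp: field_def domain_def cring_def\<close>)
  obtain h where h: "h \<in> ring_iso \<Omega> ?P" using iso unfolding is_ring_iso_def by blast
  have hom: "h \<in> ring_hom \<Omega> ?P" and bij: "bij_betw h (carrier \<Omega>) (carrier ?P)"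
    using h unfolding ring_iso_def by auto
  have h0: "h \<zero>\<^bsub>\<Omega>\<^esub> = \<zero>\<^bsub>?P\<^esub>" by (rule ring_hom_zero[OF hom ring_axioms \<open>ring ?P\<close>])
  have hc: "h a \<in> carrier ?P" if "a \<in> carrier \<Omega>" for a using bij_betwE[OF bij] that by blast
  define supp where "supp a = {i. i < ?k \<and> h a ! i \<noteq> \<zero>\<^bsub>Rs ! i\<^esub>}" for a
  have zero: "a = \<zero>\<^bsub>\<Omega>\<^esub> \<longleftrightarrow> supp a = {}" if "a \<in> carrier \<Omega>" for a
  proof -
    have "a = \<zero>\<^bsub>\<Omega>\<^esub> \<longleftrightarrow> h a = \<zero>\<^bsub>?P\<^esub>"
      using inj_on_eq_iff[OF bij_betw_imp_inj_on[OF bij] that zero_closed] h0 by simp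
    also have "\<dots> \<longleftrightarrow> (\<forall>i<?k. h a ! i = \<zero>\<^bsub>Rs ! i\<^esub>)"
      using RDirProd_list_carrier_mem(1)[OF hc[OF that]]
      by (simp add: list_eq_iff_nth_eq RDirProd_list_zero_nth)
    also have "\<dots> \<longleftrightarrow> supp a = {}" unfolding supp_def by blast
    finally show ?thesis .
  qed
  have supp_mult: "supp (a \<otimes>\<^bsub>\<Omega>\<^esub> b) = supp a \<inter> supp b" if ab: "a \<in> carrier \<Omega>" "b \<in> carrier \<Omega>" for a b
  proof -
    have "h (a \<otimes>\<^bsub>\<Omega>\<^esub> b) ! i = \<zero>\<^bsub>Rs ! i\<^esub> \<longleftrightarrow> h a ! i = \<zero>\<^bsub>Rs ! i\<^esub> \<or> h b ! i = \<zero>\<^bsub>Rs ! i\<^esub>"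
      if i: "i < ?k" for i
    proof -
      interpret R: field "Rs ! i" by (rule field[OF i])
      have "h (a \<otimes>\<^bsub>\<Omega>\<^esub> b) ! i = h a ! i \<otimes>\<^bsub>Rs ! i\<^esub> h b ! i"
        unfolding ring_hom_mult[OF hom ab] by (rule RDirProd_list_mult_nth[OF hc[OF ab(1)] hc[OF ab(2)] i])
      moreover have "h a ! i \<in> carrier (Rs ! i)" "h b ! i \<in> carrier (Rs ! i)"
        using RDirProd_list_carrier_mem(2)[OF hc[OF ab(1)] i] RDirProd_list_carrier_mem(2)[OF hc[OF ab(2)] i] .
      ultimately show ?thesis using R.integral_iff by simp
    qed
    then show ?thesis unfolding supp_def by blast
  qed
  have mult_zero: "a \<otimes>\<^bsub>\<Omega>\<^esub> b = \<zero>\<^bsub>\<Omega>\<^esub> \<longleftrightarrow> supp a \<inter> supp b = {}" if "a \<in> carrier \<Omega>" "b \<in> carrier \<Omega>" for a b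
    using zero[OF m_closed[OF that]] supp_mult[OF that] by simp
  have pos: "card (Units (Rs ! i)) \<ge> 1" if "i < ?k" for i
    using fields[of "Rs ! i"] that by (intro card_Units_finite_field) simp_all
  have count: "card {a \<in> carrier \<Omega>. supp a = B} = (\<Prod>i\<in>B. card (Units (Rs ! i)))" if B: "B \<subseteq> {..<?k}" for B
  proof -
    have "bij_betw h {a \<in> carrier \<Omega>. supp a = B}
        {as \<in> carrier ?P. {i. i < ?k \<and> as ! i \<noteq> \<zero>\<^bsub>Rs ! i\<^esub>} = B}"
      unfolding bij_betw_def
    proof
      show "inj_on h {a \<in> carrier \<Omega>. supp a = B}"
        by (rule inj_on_subset[OF bij_betw_imp_inj_on[OF bij]]) blast
      show "h ` {a \<in> carrier \<Omega>. supp a = B} = {as \<in> carrier ?P. {i. i < ?k \<and> as ! i \<noteq> \<zero>\<^bsub>Rs ! i\<^esub>} = B}"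
        unfolding supp_def bij_betw_imp_surj_on[OF bij, symmetric] by blast
    qed
    from bij_betw_same_card[OF this] card_RDirProd_list_support[OF field B]
    show ?thesis by (rule trans)
  qed
  have W: "a \<in> ?W \<longleftrightarrow> a \<in> carrier \<Omega> \<and> supp a \<noteq> {} \<and> supp a \<noteq> {..<?k}" for a
  proof (intro iffI conjI)
    assume a: "a \<in> ?W"
    then show ac: "a \<in> carrier \<Omega>" unfolding nonzero_zero_divisors_def by blast
    then show "supp a \<noteq> {}" using a zero unfolding nonzero_zero_divisors_def by blast
    obtain b where "b \<in> carrier \<Omega>" "b \<noteq> \<zero>\<^bsub>\<Omega>\<^esub>" "a \<otimes>\<^bsub>\<Omega>\<^esub> b = \<zero>\<^bsub>\<Omega>\<^esub>"
      using a unfolding nonzero_zero_divisors_def by blast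
    then have "supp b \<noteq> {}" "supp a \<inter> supp b = {}" using zero mult_zero ac by blast+
    moreover have "supp b \<subseteq> {..<?k}" unfolding supp_def by blast
    ultimately show "supp a \<noteq> {..<?k}" by blast
  next
    assume a: "a \<in> carrier \<Omega> \<and> supp a \<noteq> {} \<and> supp a \<noteq> {..<?k}"
    then obtain i where i: "i < ?k" "i \<notin> supp a" unfolding supp_def by blast
    have "card {b \<in> carrier \<Omega>. supp b = {i}} \<ge> 1" using count[of "{i}"] pos[OF i(1)] i(1) by simp
    then have "{b \<in> carrier \<Omega>. supp b = {i}} \<noteq> {}" by (metis card.empty not_one_le_zero)
    then obtain b where b: "b \<in> carrier \<Omega>" "supp b = {i}" by blast
    have "a \<otimes>\<^bsub>\<Omega>\<^esub> b = \<zero>\<^bsub>\<Omega>\<^esub>" "a \<noteq> \<zero>\<^bsub>\<Omega>\<^esub>" "b \<noteq> \<zero>\<^bsub>\<Omega>\<^esub>"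
      using a b i mult_zero[of a b] zero[of a] zero[of b] by simp_all
    then show "a \<in> ?W" using a b(1) unfolding nonzero_zero_divisors_def by blast
  qed
  have "free_homology (clique_complex {v \<in> ?W. supp v \<subseteq> {..<?k}} (zero_divisor_adj \<Omega>)) (int m - 1)
    (weighted_partitions (\<lambda>i. card (Units (Rs ! i))) {..<?k} m)"
  proof (rule free_homology_disjoint_supports[where K = "{..<?k}"])
    show "finite ?W" by (rule finite_subset[OF _ fin]) (auto simp: nonzero_zero_divisors_def)
    show "2 \<le> card {..<?k}" using k by simp
    show "supp v \<subseteq> {..<?k} \<and> supp v \<noteq> {} \<and> supp v \<noteq> {..<?k}" if "v \<in> ?W" for v
      using that W[of v] unfolding supp_def by blast
    show "zero_divisor_adj \<Omega> a b \<longleftrightarrow> supp a \<inter> supp b = {}" if "a \<in> ?W" "b \<in> ?W" for a b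
      using that W mult_zero[of a b] unfolding zero_divisor_adj_def by auto
    show "card {v \<in> ?W. supp v = B} = (\<Prod>i\<in>B. card (Units (Rs ! i)))"
      if "B \<subseteq> {..<?k}" "B \<noteq> {}" "B \<noteq> {..<?k}" for B
    proof -
      have "{v \<in> ?W. supp v = B} = {a \<in> carrier \<Omega>. supp a = B}" using W that(2,3) by blast
      then show ?thesis using count[OF that(1)] by simp
    qed
    show "card (Units (Rs ! i)) \<ge> 1" if "i \<in> {..<?k}" for i using pos that by simp
  qed (use m in auto)
  moreover have "{v \<in> ?W. supp v \<subseteq> {..<?k}} = ?W" unfolding supp_def by blast
  ultimately show ?thesis unfolding zero_divisor_complex_def by simp
qed

lemma finite_Union_zero_divisor_complex:
  assumes "finite (carrier \<Omega>)"
  shows "finite (\<Union>(zero_divisor_complex \<Omega>))"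
  unfolding zero_divisor_complex_def
  by (intro finite_Union_clique_complex finite_subset[OF _ assms]) (auto simp: nonzero_zero_divisors_def)

theorem theorem3p3:
  fixes \<Omega> :: "('a, 'm) ring_scheme"
    and Rs :: "('b, 'n) ring_scheme list"
    and us :: "nat list"
    and k :: nat
  assumes "cring \<Omega>" and "finite (carrier \<Omega>)"
    and "\<And>R. R \<in> set Rs \<Longrightarrow> field R \<and> finite (carrier R)"
    and "\<Omega> \<simeq> RDirProd_list Rs"
    and "k = length Rs" and "k \<ge> 2"
    and "us = map (\<lambda>R. card (Units R)) Rs"
  shows "int (betti (zero_divisor_complex \<Omega>) (int k - 1)) = sigma (int k) us
    \<and> (\<forall>j::nat. j \<ge> 2 \<and> j \<noteq> k \<longrightarrow>
         int (betti (zero_divisor_complex \<Omega>) (int k - int j))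
           = (\<Sum>t = 1..j - 1. int (coeffA (j - 1) t) * sigma (int k - int j - int t + 1) us))
    \<and> (\<forall>j\<ge>1. coeffA j 1 = 1)
    \<and> (\<forall>j t. 2 \<le> t \<and> t \<le> j - 1 \<longrightarrow>
         coeffA (j - 1) t
           = (\<Sum>s = 1..j - t. coeffA (j - 1 - s) (t - 1) * ((j + t - 2) choose s)))"
proof (intro conjI allI impI)
  let ?K = "zero_divisor_complex \<Omega>" and ?w = "weighted_partitions (\<lambda>i. us ! i) {..<k}"
  have len: "length us = k" using assms(5,7) by simp
  have pos: "us ! i \<ge> 1" if i: "i < length us" for i
  proof -
    have "Rs ! i \<in> set Rs" "us ! i = card (Units (Rs ! i))" using i assms(7) by auto
    then show ?thesis using assms(3)[of "Rs ! i"] card_Units_finite_field[of "Rs ! i"] by simp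
  qed
  note betti = betti_free_homology[OF finite_Union_zero_divisor_complex[OF assms(2)]]
  \<comment> \<open>degree \<open>m - 1\<close> belongs to the partitions into \<open>m\<close> blocks\<close>
  have w: "betti ?K (int m - 1) = ?w m" if "m \<noteq> 1" for m
  proof -
    have "?w m = weighted_partitions (\<lambda>i. card (Units (Rs ! i))) {..<k} m"
      unfolding weighted_partitions_def assms(7)
      by (intro sum.cong arg_cong2[where f = "(*)"] prod.cong refl) (auto simp: assms(5))
    then show ?thesis
      using betti[OF free_homology_zero_divisor_complex[OF assms(1-4) _ that]] assms(5,6) by simp
  qed
  show "int (betti ?K (int k - 1)) = sigma (int k) us"
    using w[of k] weighted_partitions_top[OF pos] len assms(6) by simp
  fix j :: nat
  show "int (betti ?K (int k - int j))
    = (\<Sum>t = 1..j - 1. int (coeffA (j - 1) t) * sigma (int k - int j - int t + 1) us)"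
    if j: "j \<ge> 2 \<and> j \<noteq> k"
  proof (cases "j < k")
    case True
    then have "int k - int j = int (k - j + 1) - 1" "k - j + 1 \<noteq> 1" by auto
    then show ?thesis using w[of "k - j + 1"] weighted_partitions_coeffA[OF pos, of j] True j len by simp
  next
    case False
    have "betti ?K (int k - int j) = 0"
    \<comment> \<open>degree \<open>-1\<close>: a nonempty set has no partition into \<open>0\<close> blocks\<close>
    proof (cases "j = Suc k")
      case True
      then show ?thesis using w[of 0] weighted_partitions_0[of "{..<k}"] assms(6) by (simp add: lessThan_empty_iff)
    next
      case ne: False
      then show ?thesis using False j by (intro betti free_homology_below) auto
    qed
    moreover have "sigma (int k - int j - int t + 1) us = 0" if "t \<in> {1..j - 1}" for t
      using False j that by (intro sigma_negative) auto
    ultimately show ?thesis by simp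
  qed
  show "coeffA j 1 = 1" if "j \<ge> 1" by simp
  fix t :: nat assume t: "2 \<le> t \<and> t \<le> j - 1"
  then obtain r where r: "t = Suc (Suc r)" by (metis add_2_eq_Suc le_Suc_ex)
  have "j - 1 - Suc r = j - t" "j - 1 + Suc r = j + t - 2" "t - 1 = Suc r" using t r by auto
  then show "coeffA (j - 1) t = (\<Sum>s = 1..j - t. coeffA (j - 1 - s) (t - 1) * ((j + t - 2) choose s))"
    unfolding r by (simp only: coeffA.simps)
qed

end
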